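(* For every integer $b\geq 2$, every integer $k\geq 1$ and every pair of reals $0<\theta<\varepsilon\leq 1$ there exists an integer $N$ with the following property. If $T$ is a finite homogeneous tree with branching number $b$ and of height at least $N$ and $\{A_t:t\in T\}$ is a family of measurable events in a probability space $(\Omega,\Sigma,\mu)$ satisfying $\mu(A_t)\geq\varepsilon$ for every $t\in T$, then there exists a strong subtree $S$ of $T$ of height $k$ such that $$\mu\Big(\bigcap_{t\in S}A_t\Big)\geq\theta^{p(b,k)},\qquad\text{where } p(b,k)=\frac{(2^b-1)^k-1}{2^b-2}.$$
   Context: A tree is a non-empty partially ordered set $(T,<)$ such that for every $t\in T$ the set $\{s\in T:s<t\}$ is finite and linearly ordered; its cardinality is the length $\ell_T(t)$ of $t$. For $n\in\mathbb{N}=\{0,1,2,\dots\}$ the $n$-level is $T(n)=\{t\in T:\ell_T(t)=n\}$. The height $h(T)$ is $\max\{n:T(n)\neq\emptyset\}+1$ if some level is empty, and $\infty$ otherwise. The immediate successors of $t$ in $T$ are the $s\geq t$ with $\ell_T(s)=\ell_T(t)+1$; write $\mathrm{ImmSucc}_T(t)$ for the set of them. $T$ is uniquely rooted if $|T(0)|=1$, and balanced if all maximal chains of $T$ have the same cardinality. A subtree of $T$ is a subset of $T$ with the induced order. A (finite or infinite) subtree $S$ of a uniquely rooted tree $T$ is strong if: (a) $S$ is uniquely rooted and balanced; (b) every level of $S$ is a subset of some level of $T$; (c) for every non-maximal node $s\in S$ and every $t\in\mathrm{ImmSucc}_T(s)$ there is a unique $s'\in\mathrm{ImmSucc}_S(s)$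 with $t\leq s'$. For an integer $b\geq2$, $b^{<\mathbb{N}}$ is the tree of all finite sequences with values in $\{0,\dots,b-1\}$ ordered by end-extension. A finite homogeneous tree with branching number $b$ is a strong subtree of $b^{<\mathbb{N}}$ of finite height (equivalently, up to isomorphism: a uniquely rooted balanced tree of finite height all of whose non-maximal nodes have exactly $b$ immediate successors). *)

theory Defs
  imports
    "HOL-Probability.Probability"
    "HOL-Library.Equipollence"
    "HOL-Library.Extended_Nat"
    "HOL-Library.Prefix_Order"
begin

text \<open>
  A tree is a set in an ordered type and carries the induced order; a subtree is just a subset.
  All notions below (length, levels, successors, height) are relative to the carrier set, because
  they change on passing to a subset. On lists, \<open>\<le>\<close> is the prefix order.
\<close>

definition is_tree :: "'a::order set \<Rightarrow> bool" where
  "is_tree T \<longleftrightarrow> T \<noteq> {} \<and>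
     (\<forall>t\<in>T. finite {s\<in>T. s < t} \<and>
        (\<forall>x\<in>{s\<in>T. s < t}. \<forall>y\<in>{s\<in>T. s < t}. x \<le> y \<or> y \<le> x))"

definition tree_len :: "'a::order set \<Rightarrow> 'a \<Rightarrow> nat" where
  "tree_len T t = card {s\<in>T. s < t}"

definition level :: "'a::order set \<Rightarrow> nat \<Rightarrow> 'a set" where
  "level T n = {t\<in>T. tree_len T t = n}"

definition tree_height :: "'a::order set \<Rightarrow> enat" where
  "tree_height T =
     (if \<exists>n. level T n = {} then enat (Max {n. level T n \<noteq> {}} + 1) else \<infinity>)"

definition imm_succ :: "'a::order set \<Rightarrow> 'a \<Rightarrow> 'a set" where
  "imm_succ T t = {s\<in>T. t \<le> s \<and> tree_len T s = tree_len T t + 1}"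

definition uniquely_rooted :: "'a::order set \<Rightarrow> bool" where
  "uniquely_rooted T \<longleftrightarrow> card (level T 0) = 1"

definition balanced :: "'a::order set \<Rightarrow> bool" where
  "balanced T \<longleftrightarrow>
     (\<forall>C D. pred_on.maxchain T (<) C \<longrightarrow> pred_on.maxchain T (<) D \<longrightarrow> C \<approx> D)"

definition strong_subtree :: "'a::order set \<Rightarrow> 'a set \<Rightarrow> bool" where
  "strong_subtree T S \<longleftrightarrow>
     is_tree T \<and> uniquely_rooted T \<and> S \<subseteq> T \<and>
     uniquely_rooted S \<and> balanced S \<and>
     (\<forall>n. \<exists>m. level S n \<subseteq> level T m) \<and>
     (\<forall>s\<in>S. (\<exists>u\<in>S. s < u) \<longrightarrow>
        (\<forall>t\<in>imm_succ T s. \<exists>!s'. s' \<in> imm_succ S s \<and> t \<le> s'))"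

definition full_tree :: "nat \<Rightarrow> nat list set" where
  "full_tree b = lists {..<b}"

definition homogeneous_tree :: "nat \<Rightarrow> nat list set \<Rightarrow> bool" where
  "homogeneous_tree b T \<longleftrightarrow> strong_subtree (full_tree b) T \<and> tree_height T \<noteq> \<infinity>"

definition exponent :: "nat \<Rightarrow> nat \<Rightarrow> real" where
  "exponent b k = ((2 ^ b - 1) ^ k - 1) / (2 ^ b - 2)"

text \<open>
  The property required of \<open>N\<close>, for all probability spaces whose points are of type \<open>'w\<close>.
  The type is an explicit argument so that one and the same \<open>N\<close> can be considered for
  different types of points.
\<close>

definition sufficient_height ::
  "'w itself \<Rightarrow> nat \<Rightarrow> nat \<Rightarrow> real \<Rightarrow> real \<Rightarrow> nat \<Rightarrow> bool" where
  "sufficient_height (_ :: 'w itself) b k \<theta> \<epsilon> N \<longleftrightarrow>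
     (\<forall>T (M :: 'w measure) A.
        homogeneous_tree b T \<longrightarrow> enat N \<le> tree_height T \<longrightarrow>
        prob_space M \<longrightarrow>
        (\<forall>t\<in>T. A t \<in> sets M) \<longrightarrow> (\<forall>t\<in>T. measure M (A t) \<ge> \<epsilon>) \<longrightarrow>
        (\<exists>S. strong_subtree T S \<and> tree_height S = enat k \<and>
             measure M (\<Inter>t\<in>S. A t) \<ge> \<theta> powr exponent b k))"

text \<open>
  Quantifiers over types are not available inside a formula, so
  \<open>\<exists>N. sufficient_height TYPE('w) b k \<theta> \<epsilon> N\<close> alone would allow \<open>N\<close> to
  vary with the type \<open>'w\<close>. That a single \<open>N\<close> serves all probability spaces is expressed by
  adding that every \<open>N\<close> sufficient for spaces on \<^typ>\<open>nat\<close> is sufficient for spaces on \<open>'w\<close>.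
\<close>

end

theory Submission
  imports Defs
begin

text \<open>
  A strong subtree of height \<open>k\<close> of a tree with branching number \<open>b\<close> has
  \<open>p = 1 + b + \<dots> + b^(k-1)\<close> nodes, and \<open>p \<le> p(b,k)\<close>. Since \<open>\<theta> < 1\<close>, it is enough to find
  such a subtree whose events intersect in measure at least \<open>\<theta>^p\<close>, the value for independent
  events of measure \<open>\<theta>\<close>. The proof shows more: for suitable levels
  \<open>n\<^sub>0 < \<dots> < n\<^bsub>k-1\<^esub>\<close>, the average of the measure of the intersection over all strong
  subtrees with these levels is at least \<open>\<theta>^p\<close>. The subtree is drawn at random: its root is uniform on
  level \<open>n\<^sub>0\<close>, and above every immediate successor of a chosen node one node of the next level is
  drawn uniformly and independently.

  For a point \<open>\<omega>\<close> let \<open>D\<close> be the set of nodes whose event contains \<open>\<omega>\<close>, and let \<open>p\<^sub>n(s)\<close> be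
  the density of \<open>D\<close> in the part of level \<open>n\<close> above the node \<open>s\<close>. For fixed \<open>n\<close> this is a martingale
  along the levels of \<open>s\<close>, so its energy \<open>E (p\<^sub>n)\<^sup>2\<close> increases with the level of \<open>s\<close> and stays in
  \<open>[0,1]\<close>. A pigeonhole argument yields a base level \<open>a\<close> and arbitrarily many levels such that for
  each level \<open>n\<close> among them the energy hardly grows between \<open>a\<close> and the level just above any earlier
  one (\<open>regular_levels\<close>). Then \<open>p\<^sub>n(s)\<close> may be replaced by \<open>G\<^sub>n = p\<^sub>n\<close> taken at the
  predecessor of \<open>s\<close> in level \<open>a\<close>. The different branches of the random subtree thereby decouple, and
  the probability that all its nodes lie in \<open>D\<close> becomes approximately the average of
  \<open>\<Prod>\<^sub>j G\<^bsub>n\<^sub>j\<^esub>^(b^j)\<close> (\<open>tree_avg_approx\<close>).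

  What remains is a statement about a long sequence of functions \<open>G\<^sub>n\<close> with values in \<open>[0,1]\<close> and
  mean at least \<open>\<epsilon>\<close>: some \<open>k\<close> of them, in increasing order, satisfy
  \<open>E (\<Prod>\<^sub>j G\<^bsub>n\<^sub>j\<^esub>^(b^j)) \<ge> \<epsilon>^p - \<delta>\<close> (\<open>choose_pattern\<close>). Again by an energy
  argument, there are \<open>k\<close> consecutive blocks of indices whose block averages nearly agree with a common
  function \<open>F\<close>. Convexity of powers allows one to pass from the block average to a single member of each
  block, and \<open>E F^p \<ge> (E F)^p \<ge> \<epsilon>^p\<close>.

  The averages above are taken over words, over \<open>\<Omega>\<close>, and over products of these. Only linearity and
  positivity matter, so all of it is carried out for abstract averaging functionals. A homogeneous
  tree is the image of the tree of short words under a map that preserves the order and the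
  directions of successors (\<open>homogeneous_tree_parametrization\<close>), and such maps also describe its strong
  subtrees (\<open>strong_subtree_image\<close>).

  Finally, whether the property holds for a family of events depends only on the joint
  distribution of the finitely many events. This distribution lives on a finite set and can be
  realised on \<open>nat\<close>, whence the second half of the theorem (\<open>sufficient_height_transfer\<close>).
\<close>

section \<open>Averaging functionals\<close>

text \<open>
  Expectations as positive normalised linear functionals on all functions. For an infinite
  probability space not every function is integrable, but composing functions with the finitely
  valued map that records which events occur gives such a functional.
\<close>

definition averaging :: "(('a \<Rightarrow> real) \<Rightarrow> real) \<Rightarrow> bool" where
  "averaging E \<longleftrightarrow>
     (\<forall>f g. E (\<lambda>x. f x + g x) = E f + E g) \<and> (\<forall>c f. E (\<lambda>x. c * f x) = c * E f) \<and>
     (\<forall>f. (\<forall>x. 0 \<le> f x) \<longrightarrow> 0 \<le> E f) \<and> E (\<lambda>_. 1) = 1"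

lemma averaging_add: "averaging E \<Longrightarrow> E (\<lambda>x. f x + g x) = E f + E g"
  and averaging_cmult: "averaging E \<Longrightarrow> E (\<lambda>x. c * f x) = c * E f"
  and averaging_nonneg: "averaging E \<Longrightarrow> (\<And>x. 0 \<le> f x) \<Longrightarrow> 0 \<le> E f"
  and averaging_one: "averaging E \<Longrightarrow> E (\<lambda>_. 1) = 1"
  unfolding averaging_def by blast+

lemma averaging_const: "averaging E \<Longrightarrow> E (\<lambda>_. c) = c"
  using averaging_cmult[of E c "\<lambda>_. 1"] averaging_one[of E] by simp

lemma averaging_diff: "averaging E \<Longrightarrow> E (\<lambda>x. f x - g x) = E f - E g"
  using averaging_add[of E f "\<lambda>x. (-1) * g x"] averaging_cmult[of E "-1" g] by simp

lemma averaging_mono: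
  assumes "averaging E" "\<And>x. f x \<le> g x"
  shows "E f \<le> E g"
  using averaging_diff[OF assms(1), of g f] averaging_nonneg[OF assms(1), of "\<lambda>x. g x - f x"] assms(2)
  by simp

lemma averaging_divide: "averaging E \<Longrightarrow> E (\<lambda>x. f x / c) = E f / c"
  using averaging_cmult[of E "1 / c" f] by simp

lemma averaging_sum: "averaging E \<Longrightarrow> E (\<lambda>x. \<Sum>i\<in>I. f i x) = (\<Sum>i\<in>I. E (f i))"
proof (induction I rule: infinite_finite_induct)
  case (insert i I)
  then show ?case using averaging_add[of E "f i" "\<lambda>x. \<Sum>i\<in>I. f i x"] by simp
qed (simp_all add: averaging_const)

lemma averaging_compose:
  assumes "averaging E" "averaging F"
  shows "averaging (\<lambda>h. E (\<lambda>x. F (\<lambda>y. h (x, y))))"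
  unfolding averaging_def
  by (simp add: averaging_add[OF assms(1)] averaging_add[OF assms(2)] averaging_cmult[OF assms(1)]
      averaging_cmult[OF assms(2)] averaging_nonneg[OF assms(1)] averaging_nonneg[OF assms(2)]
      averaging_one[OF assms(1)] averaging_one[OF assms(2)])

text \<open>
  Cauchy--Schwarz: the variance of \<open>\<bar>f\<bar>\<close> is nonnegative.
\<close>

lemma averaging_sqrt_bound:
  assumes E: "averaging E" and le: "E (\<lambda>x. (f x)\<^sup>2) \<le> \<eta>\<^sup>2" and "0 \<le> \<eta>"
  shows "E (\<lambda>x. \<bar>f x\<bar>) \<le> \<eta>"
proof -
  define c where "c = E (\<lambda>x. \<bar>f x\<bar>)"
  have "0 \<le> E (\<lambda>x. (\<bar>f x\<bar> - c)\<^sup>2)"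
    by (rule averaging_nonneg[OF E]) simp
  also have "(\<lambda>x. (\<bar>f x\<bar> - c)\<^sup>2) = (\<lambda>x. (f x)\<^sup>2 + (c\<^sup>2 - (2 * c) * \<bar>f x\<bar>))"
    by (auto simp: power2_eq_square algebra_simps)
  also have "E \<dots> = E (\<lambda>x. (f x)\<^sup>2) - c\<^sup>2"
    by (simp add: averaging_add[OF E] averaging_diff[OF E] averaging_cmult[OF E] averaging_const[OF E]
        c_def[symmetric] power2_eq_square)
  finally have "c\<^sup>2 \<le> \<eta>\<^sup>2" using le by simp
  then show ?thesis using \<open>0 \<le> \<eta>\<close> unfolding c_def by (rule power2_le_imp_le)
qed

lemma power_above_tangent:
  fixes x c :: real
  assumes "0 \<le> x" "0 \<le> c"
  shows "c ^ n + real n * c ^ (n - 1) * (x - c) \<le> x ^ n"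
proof (induction n)
  case (Suc n)
  show ?case
  proof (cases n)
    case 0
    then show ?thesis by simp
  next
    case (Suc m)
    have "c ^ Suc n + real (Suc n) * c ^ n * (x - c)
        = x * (c ^ n + real n * c ^ (n - 1) * (x - c)) - real n * c ^ (n - 1) * (x - c)\<^sup>2"
      by (simp add: Suc power2_eq_square algebra_simps)
    also have "\<dots> \<le> x * (c ^ n + real n * c ^ (n - 1) * (x - c))"
      using assms by simp
    also have "\<dots> \<le> x * x ^ n"
      using Suc.IH assms by (intro mult_left_mono)
    finally show ?thesis by simp
  qed
qed simp

text \<open>
  Jensen's inequality for \<open>x^n\<close>, by integrating the tangent at the mean.
\<close>

lemma averaging_power:
  assumes E: "averaging E" and "\<And>x. 0 \<le> f x"
  shows "(E f) ^ n \<le> E (\<lambda>x. f x ^ n)"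
proof -
  define c where "c = E f"
  have "0 \<le> c" unfolding c_def using assms by (rule averaging_nonneg)
  have "E (\<lambda>x. c ^ n + (real n * c ^ (n - 1)) * (f x - c)) = c ^ n"
    by (simp add: averaging_add[OF E] averaging_const[OF E] averaging_cmult[OF E]
        averaging_diff[OF E] c_def[symmetric])
  moreover have "E (\<lambda>x. c ^ n + (real n * c ^ (n - 1)) * (f x - c)) \<le> E (\<lambda>x. f x ^ n)"
    using power_above_tangent[OF assms(2) \<open>0 \<le> c\<close>] by (intro averaging_mono[OF E]) simp
  ultimately show ?thesis by (simp add: c_def)
qed

text \<open>
  Turns the possibility of improving one factor of a product, uniformly in the nonnegative weight
  formed by the other factors, into a simultaneous choice for all factors. It serves twice: to pick
  one function from each block of indices, and to pick one subtree above each successor of a node.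
\<close>

lemma replace_factors:
  fixes n :: nat and E :: "('a \<Rightarrow> real) \<Rightarrow> real" and W :: "'a \<Rightarrow> real"
  assumes step: "\<And>i W. i < n \<Longrightarrow> (\<And>x. 0 \<le> W x) \<Longrightarrow> \<exists>c. P i c \<and> E (\<lambda>x. W x * f i x) \<le> E (\<lambda>x. W x * h i c x)"
    and f: "\<And>i x. 0 \<le> f i x" and h: "\<And>i c x. 0 \<le> h i c x" and W: "\<And>x. 0 \<le> W x"
  shows "\<exists>c. (\<forall>i<n. P i (c i)) \<and>
    E (\<lambda>x. W x * (\<Prod>i<n. f i x)) \<le> E (\<lambda>x. W x * (\<Prod>i<n. h i (c i) x))"
  using step W
proof (induction n arbitrary: W)
  case 0
  then show ?case by simp
next
  case (Suc n)
  have "\<exists>c. (\<forall>i<n. P i (c i)) \<and>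
      E (\<lambda>x. W x * f n x * (\<Prod>i<n. f i x)) \<le> E (\<lambda>x. W x * f n x * (\<Prod>i<n. h i (c i) x))"
    using Suc.prems by (intro Suc.IH) (auto simp: f)
  then obtain c where c: "\<forall>i<n. P i (c i)"
    "E (\<lambda>x. W x * f n x * (\<Prod>i<n. f i x)) \<le> E (\<lambda>x. W x * f n x * (\<Prod>i<n. h i (c i) x))"
    by blast
  obtain d where d: "P n d"
    "E (\<lambda>x. (W x * (\<Prod>i<n. h i (c i) x)) * f n x) \<le> E (\<lambda>x. (W x * (\<Prod>i<n. h i (c i) x)) * h n d x)"
    using Suc.prems(1)[of n "\<lambda>x. W x * (\<Prod>i<n. h i (c i) x)"] Suc.prems(2) h
    by (auto simp: prod_nonneg)
  define c' where "c' = c(n := d)"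
  have "(\<Prod>i<n. h i (c' i) x) = (\<Prod>i<n. h i (c i) x)" for x
    by (rule prod.cong) (auto simp: c'_def)
  moreover have "c' n = d" by (simp add: c'_def)
  ultimately have "E (\<lambda>x. W x * (\<Prod>i<Suc n. f i x)) \<le> E (\<lambda>x. W x * (\<Prod>i<Suc n. h i (c' i) x))"
    using order_trans[OF c(2)] d(2) by (simp add: ac_simps)
  moreover have "\<forall>i<Suc n. P i (c' i)"
    using c(1) d(1) by (auto simp: c'_def less_Suc_eq)
  ultimately show ?case by blast
qed

section \<open>Averages over words\<close>

primrec word_avg :: "nat \<Rightarrow> nat \<Rightarrow> (nat list \<Rightarrow> real) \<Rightarrow> real" where
  "word_avg b 0 h = h []"
| "word_avg b (Suc d) h = (\<Sum>i<b. word_avg b d (\<lambda>u. h (i # u))) / real b"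

lemma averaging_word_avg:
  assumes "0 < b"
  shows "averaging (word_avg b d)"
proof (induction d)
  case 0
  then show ?case by (simp add: averaging_def)
next
  case (Suc d)
  have "0 \<le> word_avg b (Suc d) f" if "\<And>u. 0 \<le> f u" for f
    using that by (auto intro!: divide_nonneg_nonneg sum_nonneg averaging_nonneg[OF Suc])
  then show ?case
    using assms unfolding averaging_def
    by (simp add: averaging_add[OF Suc] averaging_cmult[OF Suc] averaging_one[OF Suc]
        sum.distrib add_divide_distrib sum_distrib_left)
qed

definition words :: "nat \<Rightarrow> nat \<Rightarrow> nat list set" where
  "words b d = {u. length u = d \<and> set u \<subseteq> {..<b}}"

lemma word_avg_mono:
  assumes "\<And>u. u \<in> words b d \<Longrightarrow> f u \<le> g u"
  shows "word_avg b d f \<le> word_avg b d g"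
  using assms
proof (induction d arbitrary: f g)
  case 0
  then show ?case by (simp add: words_def)
next
  case (Suc d)
  have "word_avg b d (\<lambda>u. f (i # u)) \<le> word_avg b d (\<lambda>u. g (i # u))" if "i < b" for i
    using that by (intro Suc.IH Suc.prems) (auto simp: words_def)
  then show ?case by (auto intro!: divide_right_mono sum_mono)
qed

lemma word_avg_cong:
  assumes "\<And>u. u \<in> words b d \<Longrightarrow> f u = g u"
  shows "word_avg b d f = word_avg b d g"
  by (intro antisym word_avg_mono) (simp_all add: assms)

lemma word_avg_append:
  "word_avg b (d + e) h = word_avg b d (\<lambda>u. word_avg b e (\<lambda>v. h (u @ v)))"
  by (induction d arbitrary: h) simp_all

lemma word_avg_split:
  "d \<le> n \<Longrightarrow> word_avg b n h = word_avg b d (\<lambda>u. word_avg b (n - d) (\<lambda>v. h (u @ v)))"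
  using word_avg_append[of b d "n - d"] by simp

lemma word_avg_Suc_end:
  "word_avg b (Suc d) h = word_avg b d (\<lambda>u. (\<Sum>i<b. h (u @ [i])) / real b)"
  using word_avg_append[of b d 1 h] by simp

text \<open>
  Averages over words are finite sums, so exchanging them with \<open>E\<close> needs only linearity.
\<close>

lemma averaging_word_avg_swap:
  assumes "averaging E"
  shows "E (\<lambda>x. word_avg b d (\<lambda>u. f u x)) = word_avg b d (\<lambda>u. E (f u))"
  by (induction d arbitrary: f) (simp_all add: averaging_divide[OF assms] averaging_sum[OF assms])

lemma word_avg_ge_imp_ex:
  assumes "0 < b" "c \<le> word_avg b d f"
  shows "\<exists>u\<in>words b d. c \<le> f u"
  using assms(2)
proof (induction d arbitrary: f)
  case 0
  then show ?case by (simp add: words_def)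
next
  case (Suc d)
  have "\<exists>i<b. c \<le> word_avg b d (\<lambda>u. f (i # u))"
  proof (rule ccontr)
    assume "\<not> ?thesis"
    then have "(\<Sum>i<b. word_avg b d (\<lambda>u. f (i # u))) < (\<Sum>i<b. c)"
      using assms(1) by (intro sum_strict_mono) (auto simp: not_le)
    then show False using Suc.prems assms(1) by (simp add: field_simps)
  qed
  then obtain i where "i < b" "c \<le> word_avg b d (\<lambda>u. f (i # u))" by blast
  with Suc.IH obtain u where "u \<in> words b d" "c \<le> f (i # u)" by blast
  with \<open>i < b\<close> show ?case by (intro bexI[of _ "i # u"]) (auto simp: words_def)
qed

lemma word_avg_le_imp_ex:
  assumes "0 < b" "word_avg b d f \<le> c"
  shows "\<exists>u\<in>words b d. f u \<le> c"
  using word_avg_ge_imp_ex[of b "-c" d "\<lambda>u. - f u"] assms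
    averaging_cmult[OF averaging_word_avg[OF assms(1)], of d "-1" f] by auto

section \<open>Conditional averages and their energy\<close>

text \<open>
  The average of \<open>X\<close> over the extensions of \<open>s\<close> of length \<open>n\<close>, that is, the conditional expectation
  of \<open>X\<close> on level \<open>n\<close> given the first letters. The second argument \<open>x\<close> is a point of the underlying
  space, over which a further averaging functional \<open>E\<close> integrates.
\<close>

definition cond_avg :: "nat \<Rightarrow> (nat list \<Rightarrow> 'a \<Rightarrow> real) \<Rightarrow> nat \<Rightarrow> nat list \<Rightarrow> 'a \<Rightarrow> real" where
  "cond_avg b X n s x = word_avg b (n - length s) (\<lambda>u. X (s @ u) x)"

definition energy :: "(('a \<Rightarrow> real) \<Rightarrow> real) \<Rightarrow> nat \<Rightarrow> (nat list \<Rightarrow> 'a \<Rightarrow> real) \<Rightarrow> nat \<Rightarrow> nat \<Rightarrow> real" where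
  "energy E b X n l = E (\<lambda>x. word_avg b l (\<lambda>s. (cond_avg b X n s x)\<^sup>2))"

lemma cond_avg_bounds:
  assumes "0 < b" "\<And>t x. 0 \<le> X t x" "\<And>t x. X t x \<le> 1"
  shows "0 \<le> cond_avg b X n s x" "cond_avg b X n s x \<le> 1"
proof -
  note A = averaging_word_avg[OF assms(1)]
  show "0 \<le> cond_avg b X n s x"
    unfolding cond_avg_def by (rule averaging_nonneg[OF A]) (rule assms)
  show "cond_avg b X n s x \<le> 1"
    unfolding cond_avg_def
    using averaging_mono[OF A, of "\<lambda>u. X (s @ u) x" "\<lambda>_. 1"] assms(3) by (simp add: averaging_one[OF A])
qed

lemma cond_avg_tower:
  assumes "length r \<le> l" "l \<le> n"
  shows "word_avg b (l - length r) (\<lambda>s. cond_avg b X n (r @ s) x) = cond_avg b X n r x"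
proof -
  have "cond_avg b X n r x = word_avg b (l - length r + (n - l)) (\<lambda>u. X (r @ u) x)"
    using assms by (simp add: cond_avg_def)
  also have "\<dots> = word_avg b (l - length r) (\<lambda>s. word_avg b (n - l) (\<lambda>v. X (r @ s @ v) x))"
    by (simp add: word_avg_append)
  also have "\<dots> = word_avg b (l - length r) (\<lambda>s. cond_avg b X n (r @ s) x)"
    using assms by (intro word_avg_cong) (auto simp: cond_avg_def words_def)
  finally show ?thesis by simp
qed

text \<open>
  Pythagoras: refining the conditioning from level \<open>a\<close> to level \<open>l\<close> adds an increment that is
  orthogonal to what was known at level \<open>a\<close>, because its averages above nodes of level \<open>a\<close> vanish.
\<close>

lemma energy_increment:
  assumes E: "averaging E" and b: "0 < b" and "a \<le> l" "l \<le> n"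
  shows "E (\<lambda>x. word_avg b l (\<lambda>s. (cond_avg b X n s x - cond_avg b X n (take a s) x)\<^sup>2))
       = energy E b X n l - energy E b X n a"
proof -
  note A = averaging_word_avg[OF b]
  have "word_avg b l (\<lambda>s. (cond_avg b X n s x - cond_avg b X n (take a s) x)\<^sup>2)
      = word_avg b l (\<lambda>s. (cond_avg b X n s x)\<^sup>2) - word_avg b a (\<lambda>s. (cond_avg b X n s x)\<^sup>2)"
    (is "?L = _") for x
  proof -
    let ?p = "\<lambda>s. cond_avg b X n s x"
    have "?L = word_avg b a (\<lambda>r. word_avg b (l - a) (\<lambda>s. (?p (r @ s) - ?p (take a (r @ s)))\<^sup>2))"
      using \<open>a \<le> l\<close> by (rule word_avg_split)
    also have "\<dots> = word_avg b a (\<lambda>r. word_avg b (l - a) (\<lambda>s. (?p (r @ s))\<^sup>2) - (?p r)\<^sup>2)"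
    proof (rule word_avg_cong)
      fix r assume "r \<in> words b a"
      then have r: "length r = a" by (simp add: words_def)
      have tower: "word_avg b (l - a) (\<lambda>s. ?p (r @ s)) = ?p r"
        using cond_avg_tower[of r l n b X x] r assms by simp
      have "word_avg b (l - a) (\<lambda>s. (?p (r @ s) - ?p (take a (r @ s)))\<^sup>2)
          = word_avg b (l - a) (\<lambda>s. (?p (r @ s))\<^sup>2 + ((?p r)\<^sup>2 - (2 * ?p r) * ?p (r @ s)))"
        by (simp add: r power2_eq_square algebra_simps)
      also have "\<dots> = word_avg b (l - a) (\<lambda>s. (?p (r @ s))\<^sup>2) + ((?p r)\<^sup>2 - (2 * ?p r) * ?p r)"
        by (simp only: averaging_add[OF A] averaging_diff[OF A] averaging_cmult[OF A]
            averaging_const[OF A] tower)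
      finally show "word_avg b (l - a) (\<lambda>s. (?p (r @ s) - ?p (take a (r @ s)))\<^sup>2)
          = word_avg b (l - a) (\<lambda>s. (?p (r @ s))\<^sup>2) - (?p r)\<^sup>2"
        by (simp add: power2_eq_square)
    qed
    finally show ?thesis
      using word_avg_split[OF \<open>a \<le> l\<close>, of b "\<lambda>s. (?p s)\<^sup>2"] by (simp add: averaging_diff[OF A])
  qed
  then show ?thesis by (simp add: energy_def averaging_diff[OF E])
qed

lemma energy_mono:
  assumes "averaging E" "0 < b" "a \<le> l" "l \<le> n"
  shows "energy E b X n a \<le> energy E b X n l"
proof -
  have "0 \<le> E (\<lambda>x. word_avg b l (\<lambda>s. (cond_avg b X n s x - cond_avg b X n (take a s) x)\<^sup>2))"
    by (intro averaging_nonneg[OF assms(1)] averaging_nonneg[OF averaging_word_avg[OF assms(2)]]) simp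
  then show ?thesis unfolding energy_increment[OF assms] by simp
qed

lemma energy_bounds:
  assumes E: "averaging E" and b: "0 < b" and X: "\<And>t x. 0 \<le> X t x" "\<And>t x. X t x \<le> 1"
  shows "0 \<le> energy E b X n l" "energy E b X n l \<le> 1"
proof -
  note A = averaging_word_avg[OF b]
  note p = cond_avg_bounds[of b X, OF b X]
  show "0 \<le> energy E b X n l"
    unfolding energy_def by (intro averaging_nonneg[OF E] averaging_nonneg[OF A]) simp
  have "energy E b X n l \<le> E (\<lambda>x. word_avg b l (\<lambda>s. 1))"
    unfolding energy_def using p
    by (intro averaging_mono[OF E] averaging_mono[OF A]) (simp add: power_le_one)
  then show "energy E b X n l \<le> 1"
    by (simp add: averaging_one[OF E] averaging_one[OF A])
qed

lemma small_increment:
  fixes e :: "nat \<Rightarrow> real"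
  assumes "0 < c" "e (c * K) - e 0 \<le> 1"
  shows "\<exists>i<c. e (i * K + K) - e (i * K) \<le> 1 / real c"
proof (rule ccontr)
  assume "\<not> ?thesis"
  then have "(\<Sum>i<c. 1 / real c) < (\<Sum>i<c. e (Suc i * K) - e (i * K))"
    using assms(1) by (intro sum_strict_mono) (auto simp: not_le add.commute)
  also have "\<dots> = e (c * K) - e 0"
    using sum_lessThan_telescope[of "\<lambda>i. e (i * K)" c] by simp
  finally show False using assms by simp
qed

text \<open>
  Here \<open>e m\<close> stands for the energy of level \<open>m\<close>. The levels are found from the top down: once the
  highest level \<open>M\<close> is fixed, the range below it is cut into \<open>d \<ge> 1 / \<eta>\<close> windows. As \<open>e M\<close>
  is increasing with values in \<open>[0,1]\<close>, it grows by at most \<open>\<eta>\<close> over one of them, and the other levels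
  are sought inside this window. The bound uses \<open>Suc (f i)\<close> because a subtree with a node on level
  \<open>f i\<close> continues from immediate successors, one level higher.
\<close>

lemma regular_levels:
  fixes \<eta> :: real and r :: nat
  assumes "0 < \<eta>"
  shows "\<exists>K. \<forall>e c. (\<forall>m l l'. l \<le> l' \<longrightarrow> l' \<le> m \<longrightarrow> e m l \<le> e m l') \<longrightarrow> (\<forall>m l. 0 \<le> e m l \<and> e m l \<le> (1::real)) \<longrightarrow>
    (\<exists>a f. c \<le> a \<and> (\<forall>i<r. a \<le> f i \<and> f i < c + K) \<and>
       (\<forall>i j. i < j \<longrightarrow> j < r \<longrightarrow> f i < f j \<and> e (f j) (Suc (f i)) - e (f j) a \<le> \<eta>))"
proof (induction r)
  case 0
  then show ?case by auto
next
  case (Suc r)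
  then obtain K where K: "\<And>e c. \<forall>m l l'. l \<le> l' \<longrightarrow> l' \<le> m \<longrightarrow> e m l \<le> e m l' \<Longrightarrow>
      \<forall>m l. 0 \<le> e m l \<and> e m l \<le> (1::real) \<Longrightarrow>
      \<exists>a f. c \<le> a \<and> (\<forall>i<r. a \<le> f i \<and> f i < c + K) \<and>
       (\<forall>i j. i < j \<longrightarrow> j < r \<longrightarrow> f i < f j \<and> e (f j) (Suc (f i)) - e (f j) a \<le> \<eta>)" by metis
  obtain d :: nat where d: "1 / \<eta> < real d" using reals_Archimedean2 by blast
  then have "0 < d" using assms by (cases d) (auto simp: field_simps)
  have d': "1 / real d \<le> \<eta>" using d assms \<open>0 < d\<close> by (simp add: field_simps)
  show ?case
  proof (rule exI[of _ "d * K + K + 1"], intro allI impI)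
    fix e :: "nat \<Rightarrow> nat \<Rightarrow> real" and c
    assume mono: "\<forall>m l l'. l \<le> l' \<longrightarrow> l' \<le> m \<longrightarrow> e m l \<le> e m l'"
      and bd: "\<forall>m l. 0 \<le> e m l \<and> e m l \<le> 1"
    define M where "M = c + d * K + K"
    have "\<exists>i<d. e M (c + (i * K + K)) - e M (c + i * K) \<le> 1 / real d"
      by (rule small_increment[OF \<open>0 < d\<close>]) (use bd in \<open>smt (verit)\<close>)
    then obtain i where i: "i < d" "e M (c + (i * K + K)) - e M (c + i * K) \<le> \<eta>" using d' by auto
    obtain a f where af: "c + i * K \<le> a" "\<forall>j<r. a \<le> f j \<and> f j < c + i * K + K"
      "\<forall>j j'. j < j' \<longrightarrow> j' < r \<longrightarrow> f j < f j' \<and> e (f j') (Suc (f j)) - e (f j') a \<le> \<eta>"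
      using K[OF mono bd, of "c + i * K"] by blast
    have "i * K + K \<le> d * K" using mult_le_mono1[of "Suc i" d K] i(1) by simp
    then have iM: "c + i * K + K \<le> M" "c + i * K + K \<le> c + d * K" unfolding M_def by linarith+
    \<comment> \<open>If \<open>r = 0\<close>, nothing bounds the \<open>a\<close> obtained above by \<open>M\<close>.\<close>
    define a' where "a' = (if r = 0 then c else a)"
    define f' where "f' = f(r := M)"
    have top: "e M (Suc (f j)) - e M a \<le> \<eta>" if "j < r" for j
    proof -
      have fj: "a \<le> f j" "f j < c + i * K + K" using af(2) that by auto
      have "e M (Suc (f j)) \<le> e M (c + (i * K + K))"
        using mono iM(1) fj(2) by (simp add: Suc_le_eq add.assoc)
      moreover have "e M (c + i * K) \<le> e M a"
        using mono af(1) iM(1) fj by simp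
      ultimately show ?thesis using i(2) by linarith
    qed
    have range: "a' \<le> f' j \<and> f' j < c + (d * K + K + 1)" if "j < Suc r" for j
    proof (cases "j = r")
      case True
      show ?thesis
      proof (cases "r = 0")
        case False
        then have "a \<le> f 0" "f 0 < c + i * K + K" using af(2) by auto
        then show ?thesis using True False iM by (simp add: a'_def f'_def M_def)
      qed (use True in \<open>simp add: a'_def f'_def M_def\<close>)
    next
      case False
      then have "a \<le> f j" "f j < c + i * K + K" using af(2) that by auto
      then show ?thesis using False that iM by (auto simp: a'_def f'_def)
    qed
    have "c \<le> a'" using af(1) by (simp add: a'_def)
    moreover have "f' j < f' j' \<and> e (f' j') (Suc (f' j)) - e (f' j') a' \<le> \<eta>" if "j < j'" "j' < Suc r" for j j'
    proof (cases "j' = r")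
      case True
      then have "j < r" using that by simp
      then have "f j < M" using af(2) iM by fastforce
      then show ?thesis using True \<open>j < r\<close> top by (auto simp: f'_def a'_def)
    next
      case False
      then show ?thesis using that af(3) by (auto simp: f'_def a'_def)
    qed
    ultimately show "\<exists>a f. c \<le> a \<and> (\<forall>i<Suc r. a \<le> f i \<and> f i < c + (d * K + K + 1)) \<and>
       (\<forall>i j. i < j \<longrightarrow> j < Suc r \<longrightarrow> f i < f j \<and> e (f j) (Suc (f i)) - e (f j) a \<le> \<eta>)"
      using range by (intro exI[of _ a'] exI[of _ f']) auto
  qed
qed

section \<open>Finding a good pattern of exponents\<close>

text \<open>
  The recursion mirrors that of a tree: a node on the first level and \<open>b\<close> independent copies of
  the rest. The level with position \<open>i\<close> in the list thus receives the exponent \<open>b ^ i\<close>.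
\<close>

primrec pattern :: "nat \<Rightarrow> (nat \<Rightarrow> 'a \<Rightarrow> real) \<Rightarrow> nat list \<Rightarrow> 'a \<Rightarrow> real" where
  "pattern b G [] x = 1"
| "pattern b G (n # ns) x = G n x * pattern b G ns x ^ b"

lemma pattern_bounds:
  assumes "\<And>n x. 0 \<le> G n x" "\<And>n x. G n x \<le> 1"
  shows "0 \<le> pattern b G ns x" "pattern b G ns x \<le> 1"
proof -
  have "0 \<le> pattern b G ns x \<and> pattern b G ns x \<le> 1"
    by (induction ns) (auto simp: assms intro!: mult_nonneg_nonneg mult_le_one power_le_one)
  then show "0 \<le> pattern b G ns x" "pattern b G ns x \<le> 1" by auto
qed

lemma pattern_eq_prod: "pattern b G ns x = (\<Prod>i<length ns. G (ns ! i) x ^ (b ^ i))"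
  by (induction ns) (simp_all add: prod.lessThan_Suc_shift prod_power_distrib power_mult[symmetric]
      mult.commute del: prod.lessThan_Suc)

text \<open>
  Reading a word as a number in base \<open>k\<close> identifies indices below \<open>k ^ d\<close> with words of length \<open>d\<close>;
  words with a common prefix form a block of consecutive indices. In this way the energy lemmas
  for trees apply to averages over blocks.
\<close>

primrec word_value :: "nat \<Rightarrow> nat list \<Rightarrow> nat" where
  "word_value k [] = 0"
| "word_value k (i # u) = i * k ^ length u + word_value k u"

lemma word_value_less:
  assumes "u \<in> words k d"
  shows "word_value k u < k ^ d"
  using assms
proof (induction u arbitrary: d)
  case Nil
  then show ?case by (simp add: words_def)
next
  case (Cons i u)
  then have u: "word_value k u < k ^ length u" and i: "i < k" and d: "d = Suc (length u)"
    by (auto simp: words_def)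
  have "i * k ^ length u + k ^ length u \<le> k * k ^ length u"
    using mult_le_mono1[of "Suc i" k "k ^ length u"] i by simp
  then show ?case using u d by simp
qed

lemma word_value_mono:
  assumes "i < j" "v \<in> words k d" "v' \<in> words k d"
  shows "word_value k (w @ i # v) < word_value k (w @ j # v')"
proof (induction w)
  case Nil
  have "word_value k v < k ^ d" by (rule word_value_less) fact
  moreover have "i * k ^ d + k ^ d \<le> j * k ^ d"
    using mult_le_mono1[of "Suc i" j "k ^ d"] assms(1) by simp
  ultimately show ?case using assms by (simp add: words_def)
next
  case (Cons a w)
  then show ?case using assms by (simp add: words_def)
qed

lemma abs_prod_power_diff:
  fixes f :: "nat \<Rightarrow> real"
  assumes "\<And>i. 0 \<le> f i \<and> f i \<le> 1" "0 \<le> c" "c \<le> 1"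
  shows "\<bar>(\<Prod>i<k. f i ^ m i) - c ^ (\<Sum>i<k. m i)\<bar> \<le> (\<Sum>i<k. real (m i) * \<bar>f i - c\<bar>)"
proof -
  have "\<bar>(\<Prod>i<k. f i ^ m i) - (\<Prod>i<k. c ^ m i)\<bar> \<le> (\<Sum>i<k. \<bar>f i ^ m i - c ^ m i\<bar>)"
    using norm_prod_diff[of "{..<k}" "\<lambda>i. f i ^ m i" "\<lambda>i. c ^ m i"] assms
    by (simp add: power_le_one)
  also have "\<dots> \<le> (\<Sum>i<k. real (m i) * \<bar>f i - c\<bar>)"
    using norm_power_diff[of _ c] assms by (intro sum_mono) auto
  finally show ?thesis by (simp add: power_sum)
qed

text \<open>
  The energies of the \<open>d + 1\<close> scales lie in \<open>[0,1]\<close>, so some two successive scales differ by at most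
  \<open>1 / d\<close> in energy. By Pythagoras the mean squared deviation of the block averages on the finer
  scale from those on the coarser one is at most \<open>1 / d\<close>, and some block \<open>w\<close> does as well as the mean.
\<close>

lemma similar_block_averages:
  assumes E: "averaging E" and k: "0 < k" and d: "0 < d"
    and H: "\<And>u x. 0 \<le> H u x" "\<And>u x. H u x \<le> 1"
  shows "\<exists>l<d. \<exists>w\<in>words k l. \<forall>j<k.
    E (\<lambda>x. (cond_avg k H d (w @ [j]) x - cond_avg k H d w x)\<^sup>2) \<le> real k / real d"
proof -
  have "\<exists>l<d. energy E k H d (l * 1 + 1) - energy E k H d (l * 1) \<le> 1 / real d"
    using energy_bounds[where X = H, OF E k H, where n = d and l = 0] energy_bounds[where X = H, OF E k H, where n = d and l = "d * 1"]
    by (intro small_increment[OF d]) linarith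
  then obtain l where l: "l < d" "energy E k H d (Suc l) - energy E k H d l \<le> 1 / real d" by auto
  define h where "h s = E (\<lambda>x. (cond_avg k H d s x - cond_avg k H d (take l s) x)\<^sup>2)" for s
  have "word_avg k (Suc l) h \<le> 1 / real d"
    using l energy_increment[OF E k, where a = l and l = "Suc l" and n = d and X = H]
    by (simp add: averaging_word_avg_swap[OF E] h_def[abs_def] del: word_avg.simps)
  then obtain w where w: "w \<in> words k l" "(\<Sum>i<k. h (w @ [i])) / real k \<le> 1 / real d"
    unfolding word_avg_Suc_end using word_avg_le_imp_ex[OF k] by blast
  have "h (w @ [j]) \<le> real k / real d" if "j < k" for j
  proof -
    have "0 \<le> h s" for s unfolding h_def by (rule averaging_nonneg[OF E]) simp
    then have "h (w @ [j]) \<le> (\<Sum>i<k. h (w @ [i]))"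
      using that by (intro member_le_sum) auto
    with w(2) k show ?thesis by (simp add: field_simps)
  qed
  then show ?thesis using l(1) w(1) by (auto simp: h_def words_def)
qed

text \<open>
  Below, \<open>F j\<close> is the average over the block of indices that begin with \<open>w @ [j]\<close>, and all \<open>F j\<close> are
  close to the average \<open>F0\<close> over the block of \<open>w\<close>. This gives the lower bound for the product of the
  powers of the \<open>F j\<close>. Jensen's inequality then allows replacing each \<open>F j\<close> by a member of its block.
  The blocks are ordered by \<open>j\<close>, so the indices chosen are increasing.
\<close>

lemma choose_pattern:
  fixes \<epsilon> \<delta> :: real
  assumes "0 < k" "0 < \<delta>" "0 \<le> \<epsilon>"
  shows "\<exists>r. \<forall>(E :: ('a \<Rightarrow> real) \<Rightarrow> real) G. averaging E \<longrightarrow> (\<forall>i x. 0 \<le> G i x \<and> G i x \<le> 1) \<longrightarrow>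
    (\<forall>i<r. \<epsilon> \<le> E (G i)) \<longrightarrow>
    (\<exists>is. length is = k \<and> sorted_wrt (<) is \<and> set is \<subseteq> {..<r} \<and>
       \<epsilon> ^ (\<Sum>i<k. b ^ i) - \<delta> \<le> E (pattern b G is))"
proof -
  define p where "p = (\<Sum>i<k. b ^ i)"
  obtain d :: nat where d': "real k * (real p / \<delta>)\<^sup>2 < real d" using reals_Archimedean2 by blast
  moreover have "0 \<le> real k * (real p / \<delta>)\<^sup>2" by simp
  ultimately have "0 < real d" by linarith
  with d' have d: "0 < d" "real k * (real p)\<^sup>2 \<le> real d * \<delta>\<^sup>2"
    using assms by (auto simp: field_simps power_divide)
  \<comment> \<open>\<open>d\<close> is chosen so large that \<open>p * \<eta> \<le> \<delta>\<close>.\<close>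
  define \<eta> where "\<eta> = sqrt (real k / real d)"
  have \<eta>: "0 \<le> \<eta>" "\<eta>\<^sup>2 = real k / real d" by (simp_all add: \<eta>_def)
  have "(real p * \<eta>)\<^sup>2 \<le> \<delta>\<^sup>2" using d by (simp add: power_mult_distrib \<eta>(2) field_simps)
  then have p\<eta>: "real p * \<eta> \<le> \<delta>" by (rule power2_le_imp_le) (use assms(2) in simp)
  show ?thesis
  proof (intro exI[of _ "k ^ d"] allI impI)
    fix E :: "('a \<Rightarrow> real) \<Rightarrow> real" and G :: "nat \<Rightarrow> 'a \<Rightarrow> real"
    assume E: "averaging E" and G: "\<forall>i x. 0 \<le> G i x \<and> G i x \<le> 1" and \<epsilon>: "\<forall>i<k ^ d. \<epsilon> \<le> E (G i)"
    define H where "H u = G (word_value k u)" for u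
    have H: "0 \<le> H u x" "H u x \<le> 1" for u x using G by (auto simp: H_def)
    obtain l w where l: "l < d" and w: "w \<in> words k l"
      and close': "\<forall>j<k. E (\<lambda>x. (cond_avg k H d (w @ [j]) x - cond_avg k H d w x)\<^sup>2) \<le> real k / real d"
      using similar_block_averages[where H = H, OF E assms(1) d(1) H] by blast
    have close: "E (\<lambda>x. (cond_avg k H d (w @ [j]) x - cond_avg k H d w x)\<^sup>2) \<le> \<eta>\<^sup>2" if "j < k" for j
      using close' that unfolding \<eta>(2) by blast
    define F where "F j = cond_avg k H d (w @ [j])" for j
    define F0 where "F0 = cond_avg k H d w"
    have bds: "0 \<le> F j x" "F j x \<le> 1" "0 \<le> F0 x" "F0 x \<le> 1" for j x
      unfolding F_def F0_def using cond_avg_bounds[of k H, OF assms(1) H] by auto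
    note A = averaging_word_avg[OF assms(1)]
    have lw: "length w = l" using w by (simp add: words_def)
    have "word_avg k (d - l) (\<lambda>_. \<epsilon>) \<le> word_avg k (d - l) (\<lambda>u. E (H (w @ u)))"
    proof (rule word_avg_mono)
      fix u assume "u \<in> words k (d - l)"
      then have "w @ u \<in> words k d" using w l by (auto simp: words_def)
      then show "\<epsilon> \<le> E (H (w @ u))" using \<epsilon> word_value_less by (simp add: H_def)
    qed
    then have "\<epsilon> \<le> E F0"
      using lw by (simp add: F0_def cond_avg_def[abs_def] averaging_word_avg_swap[OF E] averaging_const[OF A])
    then have "\<epsilon> ^ p \<le> (E F0) ^ p" using assms(3) by (rule power_mono)
    also have "\<dots> \<le> E (\<lambda>x. F0 x ^ p)" by (rule averaging_power[OF E bds(3)])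
    also have "\<dots> \<le> E (\<lambda>x. (\<Prod>j<k. F j x ^ b ^ j) + (\<Sum>j<k. real (b ^ j) * \<bar>F j x - F0 x\<bar>))"
    proof (rule averaging_mono[OF E])
      fix x
      have "\<bar>(\<Prod>j<k. F j x ^ b ^ j) - F0 x ^ p\<bar> \<le> (\<Sum>j<k. real (b ^ j) * \<bar>F j x - F0 x\<bar>)"
        unfolding p_def by (rule abs_prod_power_diff) (use bds in auto)
      then show "F0 x ^ p \<le> (\<Prod>j<k. F j x ^ b ^ j) + (\<Sum>j<k. real (b ^ j) * \<bar>F j x - F0 x\<bar>)" by linarith
    qed
    also have "\<dots> = E (\<lambda>x. \<Prod>j<k. F j x ^ b ^ j) + (\<Sum>j<k. real (b ^ j) * E (\<lambda>x. \<bar>F j x - F0 x\<bar>))"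
      by (simp only: averaging_add[OF E] averaging_sum[OF E] averaging_cmult[OF E])
    also have "(\<Sum>j<k. real (b ^ j) * E (\<lambda>x. \<bar>F j x - F0 x\<bar>)) \<le> (\<Sum>j<k. real (b ^ j) * \<eta>)"
    proof (intro sum_mono mult_left_mono)
      fix j assume "j \<in> {..<k}"
      then show "E (\<lambda>x. \<bar>F j x - F0 x\<bar>) \<le> \<eta>"
        using close \<eta>(1) unfolding F_def F0_def by (intro averaging_sqrt_bound[OF E]) auto
    qed simp
    also have "\<dots> \<le> \<delta>" using p\<eta> by (simp add: p_def sum_distrib_right)
    finally have lower: "\<epsilon> ^ p - \<delta> \<le> E (\<lambda>x. \<Prod>j<k. F j x ^ b ^ j)" by simp

    have "\<exists>v. (\<forall>j<k. v j \<in> words k (d - Suc l)) \<and>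
        E (\<lambda>x. 1 * (\<Prod>j<k. F j x ^ b ^ j)) \<le> E (\<lambda>x. 1 * (\<Prod>j<k. H (w @ j # v j) x ^ b ^ j))"
    proof (rule replace_factors[where f = "\<lambda>j x. F j x ^ b ^ j" and h = "\<lambda>j v x. H (w @ j # v) x ^ b ^ j"
          and P = "\<lambda>_ v. v \<in> words k (d - Suc l)"])
      fix j W assume "j < k" and W: "\<And>x :: 'a. 0 \<le> (W x :: real)"
      have "E (\<lambda>x. W x * F j x ^ b ^ j)
          \<le> E (\<lambda>x. W x * word_avg k (d - Suc l) (\<lambda>v. H (w @ j # v) x ^ b ^ j))"
      proof (intro averaging_mono[OF E] mult_left_mono W)
        fix x show "F j x ^ b ^ j \<le> word_avg k (d - Suc l) (\<lambda>v. H (w @ j # v) x ^ b ^ j)"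
          using averaging_power[OF A, of "\<lambda>v. H (w @ j # v) x"] H by (simp add: F_def cond_avg_def lw)
      qed
      also have "\<dots> = word_avg k (d - Suc l) (\<lambda>v. E (\<lambda>x. W x * H (w @ j # v) x ^ b ^ j))"
        by (simp add: averaging_cmult[OF A, symmetric] averaging_word_avg_swap[OF E])
      finally show "\<exists>v. v \<in> words k (d - Suc l) \<and>
          E (\<lambda>x. W x * F j x ^ b ^ j) \<le> E (\<lambda>x. W x * H (w @ j # v) x ^ b ^ j)"
        using word_avg_ge_imp_ex[OF assms(1)] by blast
    qed (use bds H in auto)
    then obtain v where v: "\<And>j. j < k \<Longrightarrow> v j \<in> words k (d - Suc l)"
      "E (\<lambda>x. \<Prod>j<k. F j x ^ b ^ j) \<le> E (\<lambda>x. \<Prod>j<k. H (w @ j # v j) x ^ b ^ j)"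
      by auto
    define m where "m j = word_value k (w @ j # v j)" for j
    have "m j < k ^ d" if "j < k" for j
      unfolding m_def using that v(1)[OF that] w l by (intro word_value_less) (auto simp: words_def)
    moreover have "m i < m j" if "i < j" "j < k" for i j
      unfolding m_def using that v(1) by (intro word_value_mono) auto
    moreover have "E (pattern b G (map m [0..<k])) = E (\<lambda>x. \<Prod>j<k. H (w @ j # v j) x ^ b ^ j)"
      by (simp add: pattern_eq_prod[abs_def] H_def m_def)
    ultimately show "\<exists>is. length is = k \<and> sorted_wrt (<) is \<and> set is \<subseteq> {..<k ^ d} \<and>
       \<epsilon> ^ (\<Sum>i<k. b ^ i) - \<delta> \<le> E (pattern b G is)"
      using lower v(2)
      by (intro exI[of _ "map m [0..<k]"]) (auto simp: sorted_wrt_iff_nth_less p_def)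
  qed
qed

section \<open>Random strong subtrees with prescribed levels\<close>

text \<open>
  The conditional probability at the point \<open>x\<close>, given that it grows above \<open>s\<close>, that a random strong
  subtree with levels \<open>n # ns\<close> consists of nodes satisfying \<open>X\<close>, for \<open>X\<close> an indicator. The product
  over \<open>i\<close> expresses that the parts above different immediate successors are drawn independently.
\<close>

primrec tree_avg :: "nat \<Rightarrow> (nat list \<Rightarrow> 'a \<Rightarrow> real) \<Rightarrow> nat list \<Rightarrow> nat list \<Rightarrow> 'a \<Rightarrow> real" where
  "tree_avg b X [] = (\<lambda>s x. 1)"
| "tree_avg b X (n # ns) = (\<lambda>s x. word_avg b (n - length s)
     (\<lambda>u. X (s @ u) x * (\<Prod>i<b. tree_avg b X ns (s @ u @ [i]) x)))"

lemma tree_avg_bounds: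
  assumes b: "0 < b" and X: "\<And>t x. 0 \<le> X t x" "\<And>t x. X t x \<le> 1"
  shows "0 \<le> tree_avg b X ns s x" "tree_avg b X ns s x \<le> 1"
proof -
  note A = averaging_word_avg[OF b]
  have "0 \<le> tree_avg b X ns s x \<and> tree_avg b X ns s x \<le> 1"
  proof (induction ns arbitrary: s)
    case (Cons n ns)
    have "word_avg b (n - length s) (\<lambda>u. X (s @ u) x * (\<Prod>i<b. tree_avg b X ns (s @ u @ [i]) x))
       \<le> word_avg b (n - length s) (\<lambda>u. 1)"
      using Cons X by (intro averaging_mono[OF A] mult_le_one prod_nonneg prod_le_1) auto
    moreover have "0 \<le> word_avg b (n - length s) (\<lambda>u. X (s @ u) x * (\<Prod>i<b. tree_avg b X ns (s @ u @ [i]) x))"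
      using Cons X by (intro averaging_nonneg[OF A] mult_nonneg_nonneg prod_nonneg) auto
    ultimately show ?case by (simp add: averaging_one[OF A])
  qed simp
  then show "0 \<le> tree_avg b X ns s x" "tree_avg b X ns s x \<le> 1" by auto
qed

text \<open>
  \<open>D n l\<close> is the error of computing the density in level \<open>n\<close> from level \<open>a\<close> instead of level \<open>l\<close>.
  In the induction step the \<open>b\<close> factors above a node each contribute the error of the shorter list,
  averaged over one successor; together these are \<open>b\<close> times the average over all of level
  \<open>Suc n\<close>. Once the factors are replaced, they depend only on \<open>take a s\<close> and can be pulled out of the
  average, which leaves \<open>cond_avg b X n s\<close> and one further error \<open>\<eta>\<close>.
\<close>

lemma tree_avg_approx:
  fixes a :: nat and \<eta> :: real
  assumes E: "averaging E" and b: "0 < b" and X: "\<And>t x. 0 \<le> X t x" "\<And>t x. X t x \<le> 1"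
  defines "D n l \<equiv> E (\<lambda>x. word_avg b l (\<lambda>s. \<bar>cond_avg b X n s x - cond_avg b X n (take a s) x\<bar>))"
  assumes "a \<le> l" "\<And>n. n \<in> set ns \<Longrightarrow> l \<le> n \<and> D n l \<le> \<eta>" "sorted_wrt (<) ns"
    and "\<And>m n. m \<in> set ns \<Longrightarrow> n \<in> set ns \<Longrightarrow> m < n \<Longrightarrow> D n (Suc m) \<le> \<eta>"
  shows "E (\<lambda>x. word_avg b l (\<lambda>s. \<bar>tree_avg b X ns s x - pattern b (\<lambda>n. cond_avg b X n (take a s)) ns x\<bar>))
    \<le> real (\<Sum>i<length ns. b ^ i) * \<eta>"
  using assms(6-)
proof (induction ns arbitrary: l)
  case Nil
  then show ?case
    by (simp add: averaging_const[OF averaging_word_avg[OF b]] averaging_const[OF E])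
next
  case (Cons n ns)
  note A = averaging_word_avg[OF b]
  define R where "R s x = pattern b (\<lambda>n. cond_avg b X n (take a s)) ns x" for s x
  have R: "0 \<le> R s x" "R s x \<le> 1" for s x
    unfolding R_def using cond_avg_bounds[of b X, OF b X] by (auto intro!: pattern_bounds)
  have Rtake: "R (s @ u) x = R s x" if "a \<le> length s" for s u x
    using that by (simp add: R_def)
  have ln: "l \<le> n" using Cons.prems by simp
  then have aSn: "a \<le> Suc n" using Cons.prems(1) by simp
  have IH: "E (\<lambda>x. word_avg b (Suc n) (\<lambda>t. \<bar>tree_avg b X ns t x - R t x\<bar>)) \<le> real (\<Sum>i<length ns. b ^ i) * \<eta>"
    unfolding R_def using Cons.prems by (intro Cons.IH aSn) auto
  define err where "err t x = (\<Sum>i<b. \<bar>tree_avg b X ns (t @ [i]) x - R (t @ [i]) x\<bar>)" for t x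
  define \<Delta> where "\<Delta> s x = \<bar>cond_avg b X n s x - cond_avg b X n (take a s) x\<bar>" for s x
  have pointwise: "\<bar>tree_avg b X (n # ns) s x - pattern b (\<lambda>n. cond_avg b X n (take a s)) (n # ns) x\<bar>
      \<le> word_avg b (n - l) (\<lambda>u. err (s @ u) x) + \<Delta> s x" if s: "s \<in> words b l" for s x
  proof -
    have ls: "length s = l" "a \<le> length s" using s Cons.prems by (auto simp: words_def)
    have bound: "\<bar>X (s @ u) x * (\<Prod>i<b. tree_avg b X ns (s @ u @ [i]) x) - X (s @ u) x * R s x ^ b\<bar>
        \<le> err (s @ u) x" for u
    proof -
      have "\<bar>(\<Prod>i<b. tree_avg b X ns (s @ u @ [i]) x) - (\<Prod>i<b. R s x)\<bar>
          \<le> (\<Sum>i<b. \<bar>tree_avg b X ns (s @ u @ [i]) x - R s x\<bar>)"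
        using norm_prod_diff[of "{..<b}" "\<lambda>i. tree_avg b X ns (s @ u @ [i]) x" "\<lambda>i. R s x"]
          tree_avg_bounds[of b X, OF b X] R by simp
      also have "\<dots> = err (s @ u) x" using ls Rtake by (simp add: err_def)
      finally have le: "\<bar>(\<Prod>i<b. tree_avg b X ns (s @ u @ [i]) x) - R s x ^ b\<bar> \<le> err (s @ u) x" by simp
      have "\<bar>X (s @ u) x * (\<Prod>i<b. tree_avg b X ns (s @ u @ [i]) x) - X (s @ u) x * R s x ^ b\<bar>
          = X (s @ u) x * \<bar>(\<Prod>i<b. tree_avg b X ns (s @ u @ [i]) x) - R s x ^ b\<bar>"
        using X by (simp add: right_diff_distrib[symmetric] abs_mult)
      also have "\<dots> \<le> 1 * err (s @ u) x" using X le by (intro mult_mono) auto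
      finally show ?thesis by simp
    qed
    let ?P = "\<lambda>u. X (s @ u) x * (\<Prod>i<b. tree_avg b X ns (s @ u @ [i]) x)"
    have "word_avg b (n - l) ?P \<le> word_avg b (n - l) (\<lambda>u. R s x ^ b * X (s @ u) x + err (s @ u) x)"
      using bound by (intro averaging_mono[OF A]) (smt (verit) mult.commute)
    moreover have "word_avg b (n - l) (\<lambda>u. R s x ^ b * X (s @ u) x - err (s @ u) x) \<le> word_avg b (n - l) ?P"
      using bound by (intro averaging_mono[OF A]) (smt (verit) mult.commute)
    ultimately have 1: "\<bar>tree_avg b X (n # ns) s x - R s x ^ b * cond_avg b X n s x\<bar>
        \<le> word_avg b (n - l) (\<lambda>u. err (s @ u) x)"
      by (simp add: averaging_add[OF A] averaging_diff[OF A] averaging_cmult[OF A] cond_avg_def ls abs_le_iff)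
    have "\<bar>R s x ^ b * cond_avg b X n s x - R s x ^ b * cond_avg b X n (take a s) x\<bar> = R s x ^ b * \<Delta> s x"
      using R by (simp add: right_diff_distrib[symmetric] abs_mult \<Delta>_def)
    also have "\<dots> \<le> 1 * \<Delta> s x"
      using R by (intro mult_right_mono power_le_one) (auto simp: \<Delta>_def)
    finally have "\<bar>R s x ^ b * cond_avg b X n s x - pattern b (\<lambda>n. cond_avg b X n (take a s)) (n # ns) x\<bar> \<le> \<Delta> s x"
      by (simp add: R_def mult.commute)
    with 1 show ?thesis by linarith
  qed
  have "E (\<lambda>x. word_avg b l (\<lambda>s. \<bar>tree_avg b X (n # ns) s x - pattern b (\<lambda>n. cond_avg b X n (take a s)) (n # ns) x\<bar>))
     \<le> E (\<lambda>x. word_avg b l (\<lambda>s. word_avg b (n - l) (\<lambda>u. err (s @ u) x) + \<Delta> s x))"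
    by (intro averaging_mono[OF E] word_avg_mono pointwise)
  also have "\<dots> = E (\<lambda>x. word_avg b n (\<lambda>t. err t x)) + D n l"
    using word_avg_split[OF ln, of b "\<lambda>t. err t _"]
    by (simp add: averaging_add[OF A] averaging_add[OF E] D_def \<Delta>_def)
  also have "E (\<lambda>x. word_avg b n (\<lambda>t. err t x))
      = real b * E (\<lambda>x. word_avg b (Suc n) (\<lambda>t. \<bar>tree_avg b X ns t x - R t x\<bar>))"
    using b unfolding word_avg_Suc_end err_def averaging_divide[OF A] averaging_divide[OF E] by simp
  also have "\<dots> \<le> real b * (real (\<Sum>i<length ns. b ^ i) * \<eta>)"
    using IH by (intro mult_left_mono) auto
  also have "D n l \<le> \<eta>" using Cons.prems by simp
  finally have "E (\<lambda>x. word_avg b l (\<lambda>s. \<bar>tree_avg b X (n # ns) s x - pattern b (\<lambda>n. cond_avg b X n (take a s)) (n # ns) x\<bar>))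
     \<le> real b * (real (\<Sum>i<length ns. b ^ i) * \<eta>) + \<eta>" by simp
  also have "\<dots> = real (\<Sum>i<length (n # ns). b ^ i) * \<eta>"
    by (simp add: sum.lessThan_Suc_shift sum_distrib_left algebra_simps del: sum.lessThan_Suc)
  finally show ?case .
qed


text \<open>
  Drawing a root uniformly is the same as first drawing its predecessor in level \<open>a\<close>.
\<close>

lemma tree_avg_start:
  assumes "a \<le> n"
  shows "tree_avg b X (n # ns) [] x = word_avg b a (\<lambda>s. tree_avg b X (n # ns) s x)"
proof -
  have "tree_avg b X (n # ns) [] x = word_avg b a (\<lambda>s. word_avg b (n - a)
      (\<lambda>u. X (s @ u) x * (\<Prod>i<b. tree_avg b X ns (s @ u @ [i]) x)))"
    using word_avg_split[OF assms, of b "\<lambda>u. X u x * (\<Prod>i<b. tree_avg b X ns (u @ [i]) x)"] by simp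
  also have "\<dots> = word_avg b a (\<lambda>s. tree_avg b X (n # ns) s x)"
    by (rule word_avg_cong) (simp add: words_def)
  finally show ?thesis .
qed

theorem levels_with_large_average:
  fixes \<epsilon> \<delta> :: real
  assumes b: "0 < b" and k: "0 < k" and "0 < \<delta>" "0 \<le> \<epsilon>"
  shows "\<exists>N. \<forall>(E :: ('a \<Rightarrow> real) \<Rightarrow> real) X. averaging E \<longrightarrow> (\<forall>t x. 0 \<le> X t x \<and> X t x \<le> 1) \<longrightarrow>
    (\<forall>n<N. \<forall>t\<in>words b n. \<epsilon> \<le> E (X t)) \<longrightarrow>
    (\<exists>ns. length ns = k \<and> sorted_wrt (<) ns \<and> set ns \<subseteq> {..<N} \<and>
       \<epsilon> ^ (\<Sum>i<k. b ^ i) - \<delta> \<le> E (tree_avg b X ns []))"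
proof -
  define p where "p = (\<Sum>i<k. b ^ i)"
  have "1 \<le> p" using k by (cases k) (simp_all add: p_def sum.lessThan_Suc_shift del: sum.lessThan_Suc)
  \<comment> \<open>Half of \<open>\<delta>\<close> is spent on \<open>choose_pattern\<close>, half on the decoupling error \<open>p * \<eta>\<close>.\<close>
  define \<eta> where "\<eta> = \<delta> / (2 * real p)"
  have \<eta>: "0 < \<eta>" "real p * \<eta> = \<delta> / 2" using \<open>1 \<le> p\<close> assms(3) by (auto simp: \<eta>_def)
  obtain r where r: "\<forall>(E :: ('a \<times> nat list \<Rightarrow> real) \<Rightarrow> real) G. averaging E \<longrightarrow>
    (\<forall>i x. 0 \<le> G i x \<and> G i x \<le> 1) \<longrightarrow> (\<forall>i<r. \<epsilon> \<le> E (G i)) \<longrightarrow>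
    (\<exists>is. length is = k \<and> sorted_wrt (<) is \<and> set is \<subseteq> {..<r} \<and>
       \<epsilon> ^ (\<Sum>i<k. b ^ i) - \<delta> / 2 \<le> E (pattern b G is))"
    using choose_pattern[OF k half_gt_zero[OF \<open>0 < \<delta>\<close>] \<open>0 \<le> \<epsilon>\<close>] by blast
  obtain N where N: "\<forall>e c. (\<forall>m l l'. l \<le> l' \<longrightarrow> l' \<le> m \<longrightarrow> e m l \<le> e m l') \<longrightarrow>
      (\<forall>m l. 0 \<le> e m l \<and> e m l \<le> (1::real)) \<longrightarrow>
    (\<exists>a f. c \<le> a \<and> (\<forall>i<r. a \<le> f i \<and> f i < c + N) \<and>
       (\<forall>i j. i < j \<longrightarrow> j < r \<longrightarrow> f i < f j \<and> e (f j) (Suc (f i)) - e (f j) a \<le> \<eta>\<^sup>2))"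
    using regular_levels[of "\<eta>\<^sup>2" r] \<eta> by auto
  show ?thesis
  proof (rule exI[of _ N], intro allI impI)
    fix E :: "('a \<Rightarrow> real) \<Rightarrow> real" and X
    assume E: "averaging E" and X: "\<forall>t x. 0 \<le> X t x \<and> X t x \<le> 1"
      and dense: "\<forall>n<N. \<forall>t\<in>words b n. \<epsilon> \<le> E (X t)"
    have X0: "0 \<le> X t x" and X1: "X t x \<le> 1" for t x using X by auto
    note A = averaging_word_avg[OF b]
    have "\<forall>m l l'. l \<le> l' \<longrightarrow> l' \<le> m \<longrightarrow> energy E b X m l \<le> energy E b X m l'"
      using energy_mono[OF E b] by blast
    moreover have "\<forall>m l. 0 \<le> energy E b X m l \<and> energy E b X m l \<le> 1"
      using energy_bounds[OF E b, of X] X0 X1 by blast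
    ultimately obtain a f where f: "\<And>i. i < r \<Longrightarrow> a \<le> f i \<and> f i < N"
      "\<And>i j. i < j \<Longrightarrow> j < r \<Longrightarrow> f i < f j"
      "\<And>i j. i < j \<Longrightarrow> j < r \<Longrightarrow> energy E b X (f j) (Suc (f i)) - energy E b X (f j) a \<le> \<eta>\<^sup>2"
      using N[THEN spec, THEN spec, of "energy E b X" 0] by (simp add: imp_conjL) metis
    \<comment> \<open>The functions to choose from live on pairs of a point and a node of level \<open>a\<close>.\<close>
    define E' where "E' h = E (\<lambda>x. word_avg b a (\<lambda>s. h (x, s)))" for h
    have E': "averaging E'"
      unfolding E'_def[abs_def] using E A by (rule averaging_compose)
    define G where "G i = (\<lambda>(x, s). cond_avg b X (f i) (take a s) x)" for i
    have "0 \<le> G i z \<and> G i z \<le> 1" for i z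
      using cond_avg_bounds[of b X, OF b X0 X1] by (auto simp: G_def split: prod.split)
    moreover have "\<epsilon> \<le> E' (G i)" if "i < r" for i
    proof -
      have "word_avg b a (\<lambda>s. cond_avg b X (f i) (take a s) x) = word_avg b (f i) (\<lambda>t. X t x)" for x
      proof -
        have "word_avg b a (\<lambda>s. cond_avg b X (f i) (take a s) x) = word_avg b a (\<lambda>s. cond_avg b X (f i) s x)"
          by (rule word_avg_cong) (simp add: words_def)
        then show ?thesis
          using cond_avg_tower[of "[]" a "f i" b X x] f(1)[OF that] by (simp add: cond_avg_def)
      qed
      then have "E' (G i) = word_avg b (f i) (\<lambda>t. E (X t))"
        by (simp add: E'_def G_def averaging_word_avg_swap[OF E])
      moreover have "word_avg b (f i) (\<lambda>t. \<epsilon>) \<le> word_avg b (f i) (\<lambda>t. E (X t))"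
        using dense f(1)[OF that] by (intro word_avg_mono) auto
      ultimately show ?thesis by (simp add: averaging_const[OF A])
    qed
    ultimately obtain js where js: "length js = k" "sorted_wrt (<) js" "set js \<subseteq> {..<r}"
       "\<epsilon> ^ p - \<delta> / 2 \<le> E' (pattern b G js)"
      using r[rule_format, OF E', of G] unfolding p_def by blast
    define ns where "ns = map f js"
    have ns: "length ns = k" "sorted_wrt (<) ns" "set ns \<subseteq> {..<N}"
      using js f unfolding ns_def
      by (auto simp: sorted_wrt_iff_nth_less) (metis lessThan_iff nth_mem subset_iff)
    let ?P = "\<lambda>x s. pattern b (\<lambda>n. cond_avg b X n (take a s)) ns x"
    have P: "pattern b G js (x, s) = ?P x s" for x s
      unfolding ns_def by (induction js) (simp_all add: G_def)
    have gap: "E (\<lambda>x. word_avg b a (\<lambda>s. \<bar>tree_avg b X ns s x - ?P x s\<bar>)) \<le> real (\<Sum>i<length ns. b ^ i) * \<eta>"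
    proof (rule tree_avg_approx[OF E b X0 X1 order_refl])
      fix n assume "n \<in> set ns"
      then have "a \<le> n" using f(1) js(3) by (auto simp: ns_def)
      moreover have "word_avg b a (\<lambda>s. \<bar>cond_avg b X n s x - cond_avg b X n (take a s) x\<bar>) = word_avg b a (\<lambda>_. 0)" for x
        by (rule word_avg_cong) (simp add: words_def)
      ultimately show "a \<le> n \<and> E (\<lambda>x. word_avg b a (\<lambda>s. \<bar>cond_avg b X n s x - cond_avg b X n (take a s) x\<bar>)) \<le> \<eta>"
        using \<eta>(1) by (simp add: averaging_const[OF A] averaging_const[OF E])
    next
      fix m n assume "m \<in> set ns" "n \<in> set ns" "m < n"
      then obtain i j where ij: "i < r" "j < r" "m = f i" "n = f j" using js(3) by (auto simp: ns_def)
      then have "i < j" using f(2)[of j i] \<open>m < n\<close> by (cases i j rule: linorder_cases) auto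
      have am: "a \<le> Suc m" using f(1)[OF ij(1)] ij by simp
      have A': "averaging (\<lambda>h. E (\<lambda>x. word_avg b (Suc m) (\<lambda>s. h (x, s))))"
        using E A by (rule averaging_compose)
      have "E (\<lambda>x. word_avg b (Suc m) (\<lambda>s. (cond_avg b X n s x - cond_avg b X n (take a s) x)\<^sup>2)) \<le> \<eta>\<^sup>2"
        using energy_increment[OF E b am, of n X] f(3)[OF \<open>i < j\<close> ij(2)] \<open>m < n\<close> ij by simp
      then show "E (\<lambda>x. word_avg b (Suc m) (\<lambda>s. \<bar>cond_avg b X n s x - cond_avg b X n (take a s) x\<bar>)) \<le> \<eta>"
        using averaging_sqrt_bound[OF A', of "\<lambda>(x, s). cond_avg b X n s x - cond_avg b X n (take a s) x" \<eta>] \<eta>(1)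
        by simp
    qed (rule ns)
    obtain n ns' where ns_Cons: "ns = n # ns'" using ns(1) k by (cases ns) auto
    have "a \<le> n" using f(1) js(3) ns_Cons unfolding ns_def by auto
    have "E' (pattern b G js) - E (\<lambda>x. tree_avg b X ns [] x) = E (\<lambda>x. word_avg b a (\<lambda>s. ?P x s - tree_avg b X ns s x))"
      using tree_avg_start[OF \<open>a \<le> n\<close>, of b X ns', abs_def]
      by (simp add: E'_def P averaging_diff[OF A] averaging_diff[OF E] ns_Cons[symmetric])
    also have "\<dots> \<le> E (\<lambda>x. word_avg b a (\<lambda>s. \<bar>tree_avg b X ns s x - ?P x s\<bar>))"
      by (intro averaging_mono[OF E] averaging_mono[OF A]) linarith
    also have "\<dots> \<le> \<delta> / 2" using gap \<eta>(2) ns(1) by (simp add: p_def)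
    finally show "\<exists>ns. length ns = k \<and> sorted_wrt (<) ns \<and> set ns \<subseteq> {..<N} \<and>
       \<epsilon> ^ (\<Sum>i<k. b ^ i) - \<delta> \<le> E (tree_avg b X ns [])"
      using js(4) ns by (intro exI[of _ ns]) (simp add: p_def)
  qed
qed

text \<open>
  \<open>g\<close> places the words of length below \<open>length ns\<close> as a strong subtree above \<open>s\<close>, words of length
  \<open>j\<close> going to level \<open>ns ! j\<close>.
\<close>

primrec strong_copy :: "nat \<Rightarrow> nat list \<Rightarrow> nat list \<Rightarrow> (nat list \<Rightarrow> nat list) \<Rightarrow> bool" where
  "strong_copy b [] s g \<longleftrightarrow> True"
| "strong_copy b (n # ns) s g \<longleftrightarrow> s \<le> g [] \<and> g [] \<in> words b n \<and>
     (\<forall>i<b. strong_copy b ns (g [] @ [i]) (\<lambda>u. g (i # u)))"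

primrec node_prod :: "nat \<Rightarrow> (nat list \<Rightarrow> 'a \<Rightarrow> real) \<Rightarrow> nat \<Rightarrow> (nat list \<Rightarrow> nat list) \<Rightarrow> 'a \<Rightarrow> real" where
  "node_prod b X 0 g x = 1"
| "node_prod b X (Suc k) g x = X (g []) x * (\<Prod>i<b. node_prod b X k (\<lambda>u. g (i # u)) x)"

lemma node_prod_nonneg: "(\<And>t x. 0 \<le> X t x) \<Longrightarrow> 0 \<le> node_prod b X k g x"
  by (induction k arbitrary: g) (auto intro!: mult_nonneg_nonneg prod_nonneg)

text \<open>
  An average over random subtrees is attained by some subtree. The weight \<open>W\<close> carries the part of
  the subtree that is already fixed, together with the averages over parts not yet chosen, since all
  of these are multiplied before \<open>E\<close> is applied.
\<close>

lemma exists_strong_copy: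
  assumes E: "averaging E" and b: "0 < b" and X: "\<And>t x. 0 \<le> X t x" "\<And>t x. X t x \<le> 1"
    and "\<And>x. 0 \<le> W x" "sorted_wrt (<) ns" "\<And>n. n \<in> set ns \<Longrightarrow> length s \<le> n" "set s \<subseteq> {..<b}"
  shows "\<exists>g. strong_copy b ns s g \<and>
    E (\<lambda>x. W x * tree_avg b X ns s x) \<le> E (\<lambda>x. W x * node_prod b X (length ns) g x)"
  using assms(5-)
proof (induction ns arbitrary: s W)
  case Nil
  then show ?case by simp
next
  case (Cons n ns)
  note A = averaging_word_avg[OF b]
  let ?T = "\<lambda>t x. \<Prod>i<b. tree_avg b X ns (t @ [i]) x"
  have "E (\<lambda>x. W x * tree_avg b X (n # ns) s x)
      = word_avg b (n - length s) (\<lambda>u. E (\<lambda>x. W x * (X (s @ u) x * ?T (s @ u) x)))"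
    by (simp add: averaging_cmult[OF A, symmetric] averaging_word_avg_swap[OF E])
  then obtain u where u: "u \<in> words b (n - length s)"
    "E (\<lambda>x. W x * tree_avg b X (n # ns) s x) \<le> E (\<lambda>x. W x * (X (s @ u) x * ?T (s @ u) x))"
    using word_avg_ge_imp_ex[OF b] by (metis (mono_tags, lifting) order_refl)
  define t where "t = s @ u"
  have t: "t \<in> words b n" "s \<le> t"
    using u(1) Cons.prems by (auto simp: words_def t_def less_eq_list_def)
  have "\<exists>g. (\<forall>i<b. strong_copy b ns (t @ [i]) (g i)) \<and>
     E (\<lambda>x. (W x * X t x) * (\<Prod>i<b. tree_avg b X ns (t @ [i]) x))
     \<le> E (\<lambda>x. (W x * X t x) * (\<Prod>i<b. node_prod b X (length ns) (g i) x))"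
  proof (rule replace_factors[where P = "\<lambda>i. strong_copy b ns (t @ [i])" and f = "\<lambda>i. tree_avg b X ns (t @ [i])"
        and h = "\<lambda>i. node_prod b X (length ns)"])
    fix i and W :: "'a \<Rightarrow> real" assume "i < b" "\<And>x. 0 \<le> W x"
    then show "\<exists>g. strong_copy b ns (t @ [i]) g \<and>
       E (\<lambda>x. W x * tree_avg b X ns (t @ [i]) x) \<le> E (\<lambda>x. W x * node_prod b X (length ns) g x)"
      using Cons.prems t by (intro Cons.IH) (auto simp: words_def Suc_le_eq)
  qed (use Cons.prems(1) X tree_avg_bounds[of b X, OF b X] in \<open>auto intro: node_prod_nonneg\<close>)
  then obtain g where g: "\<forall>i<b. strong_copy b ns (t @ [i]) (g i)"
     "E (\<lambda>x. (W x * X t x) * (\<Prod>i<b. tree_avg b X ns (t @ [i]) x))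
     \<le> E (\<lambda>x. (W x * X t x) * (\<Prod>i<b. node_prod b X (length ns) (g i) x))" by blast
  define g' where "g' w = (case w of [] \<Rightarrow> t | i # v \<Rightarrow> g i v)" for w
  have [simp]: "g' [] = t" "(\<lambda>v. g' (i # v)) = g i" for i by (auto simp: g'_def)
  have "strong_copy b (n # ns) s g'" using t g(1) by simp
  moreover have "E (\<lambda>x. W x * tree_avg b X (n # ns) s x) \<le> E (\<lambda>x. W x * node_prod b X (length (n # ns)) g' x)"
    using order_trans[OF u(2)[folded t_def]] g(2) by (simp add: mult.assoc)
  ultimately show ?case by blast
qed


section \<open>Strong subtrees as images of truncated full trees\<close>

definition short_words :: "nat \<Rightarrow> nat \<Rightarrow> nat list set" where
  "short_words b k = {u. length u < k \<and> set u \<subseteq> {..<b}}"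

text \<open>
  Such a map sends the part above the \<open>i\<close>-th successor of \<open>u\<close> into the part above the \<open>i\<close>-th
  successor of \<open>f u\<close>. This single condition makes it an order embedding, and by it both
  homogeneous trees and their strong subtrees are parametrised.
\<close>

definition successor_map :: "nat \<Rightarrow> nat \<Rightarrow> (nat list \<Rightarrow> nat list) \<Rightarrow> bool" where
  "successor_map b k f \<longleftrightarrow> (\<forall>u i. u @ [i] \<in> short_words b k \<longrightarrow> f u @ [i] \<le> f (u @ [i]))"

lemma short_words_appendD: "u @ v \<in> short_words b k \<Longrightarrow> u \<in> short_words b k"
  by (auto simp: short_words_def)

lemma finite_short_words: "finite (short_words b k)"
proof -
  have "short_words b k \<subseteq> {u. set u \<subseteq> {..<b} \<and> length u \<le> k}" by (auto simp: short_words_def)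
  then show ?thesis using finite_lists_length_le[of "{..<b}" k] finite_subset by blast
qed

lemma successor_map_append:
  assumes "successor_map b k f" "u @ i # w \<in> short_words b k"
  shows "f u @ [i] \<le> f (u @ i # w)"
  using assms(2)
proof (induction w rule: rev_induct)
  case Nil
  then show ?case using assms(1) by (simp add: successor_map_def)
next
  case (snoc j w)
  then have "u @ i # w \<in> short_words b k" using short_words_appendD[of "u @ i # w" "[j]"] by simp
  then have "f u @ [i] \<le> f (u @ i # w)" by (rule snoc.IH)
  also have "\<dots> \<le> f (u @ i # w) @ [j]" by (simp add: less_eq_list_def)
  also have "\<dots> \<le> f ((u @ i # w) @ [j])"
    using assms(1) snoc.prems unfolding successor_map_def by (metis append.assoc append_Cons)
  finally show ?case by simp
qed

lemma successor_map_mono: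
  assumes "successor_map b k f" "v \<in> short_words b k" "u \<le> v"
  shows "f u \<le> f v"
proof -
  obtain w where v: "v = u @ w" using assms(3) by (auto simp: less_eq_list_def prefix_def)
  show ?thesis
  proof (cases w)
    case (Cons i w')
    then have "f u @ [i] \<le> f v" using successor_map_append[OF assms(1)] assms(2) v by simp
    then show ?thesis by (auto simp: less_eq_list_def prefix_def)
  qed (simp add: v)
qed

text \<open>
  Incomparable words branch at some \<open>w\<close> into different letters, and their images then branch at \<open>f w\<close>.
\<close>

lemma successor_map_le_iff:
  assumes f: "successor_map b k f" and u: "u \<in> short_words b k" and v: "v \<in> short_words b k"
  shows "f u \<le> f v \<longleftrightarrow> u \<le> v"
proof
  assume le: "f u \<le> f v"
  show "u \<le> v"
  proof (rule ccontr)
    assume "\<not> u \<le> v"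
    show False
    proof (cases "v \<le> u")
      case True
      with \<open>\<not> u \<le> v\<close> have "v < u" by (simp add: less_le_not_le)
      then obtain i w where "u = v @ i # w" by (rule strict_prefixE') blast
      then have "f v @ [i] \<le> f u" using successor_map_append[OF f] u by simp
      with le have "f v @ [i] \<le> f v" using order_trans by blast
      then show False by (auto simp: less_eq_list_def dest: prefix_length_le)
    next
      case False
      with \<open>\<not> u \<le> v\<close> have "parallel u v" by (auto simp: less_eq_list_def)
      then obtain w i u' j v' where "i \<noteq> j" "u = w @ i # u'" "v = w @ j # v'"
        using parallel_decomp by blast
      then have "f w @ [i] \<le> f u" "f w @ [j] \<le> f v" using successor_map_append[OF f] u v by simp_all
      with le have "f w @ [i] \<le> f v" "f w @ [j] \<le> f v" using order_trans by blast+
      then show False using \<open>i \<noteq> j\<close> by (auto simp: less_eq_list_def prefix_def)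
    qed
  qed
qed (rule successor_map_mono[OF f v])

lemma successor_map_less_iff:
  assumes f: "successor_map b k f" and "u \<in> short_words b k" "v \<in> short_words b k"
  shows "f u < f v \<longleftrightarrow> u < v"
  using successor_map_le_iff[OF f] assms(2,3) by (simp add: less_le_not_le)

lemma successor_map_inj:
  assumes f: "successor_map b k f"
  shows "inj_on f (short_words b k)"
  by (rule inj_onI) (metis successor_map_le_iff[OF f] order_antisym order_refl)

lemma tree_len_prefix_closed:
  fixes t :: "nat list"
  assumes "\<And>s. s \<le> t \<Longrightarrow> s \<in> X"
  shows "tree_len X t = length t"
proof -
  have "{s \<in> X. s < t} = (\<lambda>i. take i t) ` {..<length t}"
  proof (intro subset_antisym subsetI)
    fix s assume "s \<in> {s \<in> X. s < t}"
    then obtain w where "t = s @ w" "w \<noteq> []" by (auto simp: less_list_def less_eq_list_def prefix_def strict_prefix_def)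
    then show "s \<in> (\<lambda>i. take i t) ` {..<length t}"
      by (intro image_eqI[of _ _ "length s"]) auto
  next
    fix s assume "s \<in> (\<lambda>i. take i t) ` {..<length t}"
    then obtain i where i: "i < length t" "s = take i t" by auto
    then have "s \<le> t" "s \<noteq> t" using take_is_prefix[of i t] by (auto simp: less_eq_list_def)
    then show "s \<in> {s \<in> X. s < t}" using assms by auto
  qed
  moreover have "inj_on (\<lambda>i. take i t) {..<length t}"
    by (rule inj_onI) (metis length_take lessThan_iff min.absorb4)
  ultimately show ?thesis by (simp add: tree_len_def card_image)
qed

lemma short_words_prefix: "s \<le> t \<Longrightarrow> t \<in> short_words b k \<Longrightarrow> s \<in> short_words b k"
  by (auto simp: less_eq_list_def prefix_def short_words_def)

lemma tree_len_image:
  assumes f: "successor_map b k f" and u: "u \<in> short_words b k"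
  shows "tree_len (f ` short_words b k) (f u) = length u"
proof -
  have "{s \<in> f ` short_words b k. s < f u} = f ` {s \<in> short_words b k. s < u}"
    using successor_map_less_iff[OF f _ u] by auto
  then have "tree_len (f ` short_words b k) (f u) = tree_len (short_words b k) u"
    using inj_on_subset[OF successor_map_inj[OF f]] by (simp add: tree_len_def card_image)
  also have "\<dots> = length u"
    using u short_words_prefix by (intro tree_len_prefix_closed)
  finally show ?thesis .
qed

lemma level_image:
  assumes f: "successor_map b k f"
  shows "level (f ` short_words b k) n = (if n < k then f ` words b n else {})"
  using tree_len_image[OF f] by (auto simp: level_def short_words_def words_def)

lemma words_nonempty: "0 < b \<Longrightarrow> words b n \<noteq> {}"
  by (auto simp: words_def intro!: exI[of _ "replicate n 0"])

lemma tree_height_image: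
  assumes f: "successor_map b k f" and "0 < b" "0 < k"
  shows "tree_height (f ` short_words b k) = enat k"
proof -
  have "{n. level (f ` short_words b k) n \<noteq> {}} = {..<k}"
    using level_image[OF f] words_nonempty[OF assms(2)] by auto
  moreover have "Max {..<k} = k - 1" using assms(3) by (intro Max_eqI) auto
  moreover have "level (f ` short_words b k) k = {}" by (simp add: level_image[OF f])
  ultimately show ?thesis using assms(3) by (auto simp: tree_height_def)
qed

lemma imm_succ_image:
  assumes f: "successor_map b k f" and u: "u \<in> short_words b k" and "Suc (length u) < k"
  shows "imm_succ (f ` short_words b k) (f u) = (\<lambda>i. f (u @ [i])) ` {..<b}"
proof (intro subset_antisym subsetI)
  fix s assume "s \<in> imm_succ (f ` short_words b k) (f u)"
  then obtain v where v: "s = f v" "v \<in> short_words b k" "f u \<le> f v" "length v = Suc (length u)"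
    using tree_len_image[OF f] u by (auto simp: imm_succ_def)
  then have "u \<le> v" using successor_map_le_iff[OF f u] by simp
  then obtain w where "v = u @ w" by (auto simp: less_eq_list_def prefix_def)
  with v(4) obtain i where "v = u @ [i]" by (cases w) auto
  with v(1,2) show "s \<in> (\<lambda>i. f (u @ [i])) ` {..<b}" by (auto simp: short_words_def)
next
  fix s assume "s \<in> (\<lambda>i. f (u @ [i])) ` {..<b}"
  then obtain i where i: "i < b" "s = f (u @ [i])" by auto
  then have v: "u @ [i] \<in> short_words b k" using u assms(3) by (auto simp: short_words_def)
  have "f u \<le> f (u @ [i])" by (rule successor_map_mono[OF f v]) (simp add: less_eq_list_def)
  then show "s \<in> imm_succ (f ` short_words b k) (f u)"
    using i v u tree_len_image[OF f] by (simp add: imm_succ_def)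
qed

lemma prefixes_comparable: "x \<le> t \<Longrightarrow> y \<le> t \<Longrightarrow> x \<le> y \<or> y \<le> x" for t :: "nat list"
  unfolding less_eq_list_def by (rule Sublist.prefix_same_cases)

lemma chain_below:
  fixes X :: "nat list set"
  shows "pred_on.chain X (<) {s \<in> X. s \<le> c}"
  unfolding pred_on.chain_def
  using prefixes_comparable by (auto simp: less_le)

lemma maxchain_below_maximal:
  fixes X :: "nat list set"
  assumes "c \<in> X" "\<And>u. u \<in> X \<Longrightarrow> \<not> c < u"
  shows "pred_on.maxchain X (<) {s \<in> X. s \<le> c}"
  unfolding pred_on.maxchain_def
proof (intro conjI notI)
  show "pred_on.chain X (<) {s \<in> X. s \<le> c}" by (rule chain_below)
  assume "\<exists>S. pred_on.chain X (<) S \<and> {s \<in> X. s \<le> c} \<subset> S"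
  then obtain S where S: "pred_on.chain X (<) S" "{s \<in> X. s \<le> c} \<subset> S" by blast
  then obtain s where "s \<in> S" "s \<notin> {s \<in> X. s \<le> c}" by blast
  moreover have "c \<in> S" using S(2) assms(1) by auto
  ultimately have "s \<in> X" "\<not> s \<le> c" "s < c \<or> s = c \<or> c < s"
    using S(1) unfolding pred_on.chain_def by auto
  then show False using assms(2) by auto
qed

text \<open>
  Together with the preceding lemma, this reduces balancedness to the statement that all maximal
  nodes have the same length.
\<close>

lemma maxchain_eq_below_maximal:
  fixes X :: "nat list set"
  assumes "finite X" "X \<noteq> {}" "pred_on.maxchain X (<) C"
  shows "\<exists>c\<in>X. C = {s \<in> X. s \<le> c} \<and> (\<forall>u\<in>X. \<not> c < u)"
proof -
  have chain: "pred_on.chain X (<) C" and max: "\<And>S. pred_on.chain X (<) S \<Longrightarrow> \<not> C \<subset> S"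
    using assms(3) unfolding pred_on.maxchain_def by blast+
  then have C: "C \<subseteq> X" "\<And>x y. x \<in> C \<Longrightarrow> y \<in> C \<Longrightarrow> x < y \<or> x = y \<or> y < x"
    unfolding pred_on.chain_def by blast+
  obtain x where "x \<in> X" using assms(2) by blast
  then have "C \<noteq> {}" using max[of "{x}"] by (auto simp: pred_on.chain_def)
  moreover have "finite C" using C(1) assms(1) finite_subset by blast
  ultimately obtain c where c: "c \<in> C" "\<And>s. s \<in> C \<Longrightarrow> \<not> c < s"
    using finite_has_maximal[of C] by (metis less_le)
  then have sub: "C \<subseteq> {s \<in> X. s \<le> c}" using C by fastforce
  have no: "\<not> c < u" if "u \<in> X" for u
  proof
    assume "c < u"
    then have "C \<subset> {s \<in> X. s \<le> u}" using sub that c(2) by fastforce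
    then show False using max[OF chain_below] by blast
  qed
  have "C = {s \<in> X. s \<le> c}" using sub max[OF chain_below, of c] by blast
  then show ?thesis using no c(1) C(1) by blast
qed

lemma card_below:
  assumes "c \<in> X" "finite {s \<in> X. s < c}"
  shows "card {s \<in> X. s \<le> c} = Suc (tree_len X c)"
proof -
  have "{s \<in> X. s \<le> c} = insert c {s \<in> X. s < c}" using assms(1) by auto
  then show ?thesis using assms(2) by (simp add: tree_len_def)
qed

lemma balanced_image:
  assumes f: "successor_map b k f" and "0 < b" "0 < k"
  shows "balanced (f ` short_words b k)"
proof -
  let ?X = "f ` short_words b k"
  have fin: "finite ?X" using finite_short_words by simp
  have "[] \<in> short_words b k" using assms(3) by (simp add: short_words_def)
  then have ne: "?X \<noteq> {}" by blast
  have "card C = k \<and> finite C" if max: "pred_on.maxchain ?X (<) C" for C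
  proof -
    obtain c where c: "c \<in> ?X" "C = {s \<in> ?X. s \<le> c}" "\<forall>u\<in>?X. \<not> c < u"
      using maxchain_eq_below_maximal[OF fin ne max] by blast
    from c(1) obtain v where "v \<in> short_words b k" "c = f v" by blast
    with c have v: "v \<in> short_words b k" "C = {s \<in> ?X. s \<le> f v}" "\<forall>u\<in>?X. \<not> f v < u" by auto
    have "\<not> Suc (length v) < k"
    proof
      assume "Suc (length v) < k"
      then have "v @ [0] \<in> short_words b k" using v(1) assms(2) by (auto simp: short_words_def)
      moreover have "v < v @ [0]" by (simp add: less_list_def strict_prefix_def)
      ultimately show False using v successor_map_less_iff[OF f] by blast
    qed
    then have "Suc (length v) = k" using v(1) by (auto simp: short_words_def)
    moreover have "card C = Suc (length v)"
      unfolding v(2) using v(1) tree_len_image[OF f v(1)] fin by (subst card_below) auto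
    ultimately show ?thesis using v(2) fin by simp
  qed
  then show ?thesis unfolding balanced_def by (metis eqpoll_iff_card)
qed

lemma is_tree_lists:
  fixes X :: "nat list set"
  assumes "X \<noteq> {}"
  shows "is_tree X"
  unfolding is_tree_def
proof (intro conjI ballI assms)
  fix t assume "t \<in> X"
  have "{s \<in> X. s < t} \<subseteq> set (prefixes t)"
    by (auto dest!: less_imp_le simp: less_eq_list_def)
  then show "finite {s \<in> X. s < t}" using finite_subset by blast
  fix x y assume "x \<in> {s \<in> X. s < t}" "y \<in> {s \<in> X. s < t}"
  then have "x \<le> t" "y \<le> t" by auto
  then show "x \<le> y \<or> y \<le> x" by (rule prefixes_comparable)
qed

text \<open>
  The composition \<open>e \<circ> g\<close> is again a successor map, so the immediate successors in both trees are
  given by \<open>imm_succ_image\<close>: the node \<open>e (g u @ [j])\<close> lies below \<open>e (g (u @ [i']))\<close> exactly if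
  \<open>i' = j\<close>.
\<close>

lemma strong_subtree_image:
  assumes b: "0 < b" and k: "0 < k" and e: "successor_map b H e" and g: "successor_map b k g"
    and g_in: "\<And>u. u \<in> short_words b k \<Longrightarrow> g u \<in> short_words b H"
    and g_level: "\<And>u. u \<in> short_words b k \<Longrightarrow> length (g u) = l (length u)"
  shows "strong_subtree (e ` short_words b H) (e ` g ` short_words b k)"
    and "tree_height (e ` g ` short_words b k) = enat k"
proof -
  define f where "f = e \<circ> g"
  have f: "successor_map b k f"
    unfolding successor_map_def
  proof (intro allI impI)
    fix u i assume ui: "u @ [i] \<in> short_words b k"
    then have "g u @ [i] \<le> g (u @ [i])" using g by (simp add: successor_map_def)
    moreover from this have "g u @ [i] \<in> short_words b H" using g_in[OF ui] short_words_prefix by blast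
    moreover from this have "e (g u) @ [i] \<le> e (g u @ [i])" using e by (simp add: successor_map_def)
    ultimately show "f u @ [i] \<le> f (u @ [i])"
      using successor_map_mono[OF e g_in[OF ui]] by (auto simp: f_def intro: order_trans)
  qed
  let ?T = "e ` short_words b H" and ?S = "f ` short_words b k"
  have S: "e ` g ` short_words b k = ?S" by (simp add: f_def image_comp)
  show "tree_height (e ` g ` short_words b k) = enat k"
    unfolding S by (rule tree_height_image[OF f b k])
  have root: "[] \<in> short_words b k" using k by (simp add: short_words_def)
  then have H: "0 < H" using g_in[of "[]"] by (auto simp: short_words_def)
  have w0: "words b 0 = {[]}" by (auto simp: words_def)
  show "strong_subtree ?T (e ` g ` short_words b k)"
    unfolding strong_subtree_def S
  proof (intro conjI allI ballI impI)
    show "is_tree ?T" using H by (intro is_tree_lists) (auto simp: short_words_def intro: exI[of _ "[]"])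
    show "uniquely_rooted ?T" using H by (simp add: uniquely_rooted_def level_image[OF e] w0)
    show "?S \<subseteq> ?T" using g_in by (auto simp: f_def)
    show "uniquely_rooted ?S" using k by (simp add: uniquely_rooted_def level_image[OF f] w0)
    show "balanced ?S" by (rule balanced_image[OF f b k])
    show "\<exists>m. level ?S n \<subseteq> level ?T m" for n
    proof (cases "n < k")
      case True
      have "f u \<in> level ?T (l n)" if "u \<in> words b n" for u
      proof -
        have "u \<in> short_words b k" using that True by (simp add: words_def short_words_def)
        then show ?thesis
          using g_in g_level[of u] tree_len_image[OF e] that by (simp add: level_def f_def words_def)
      qed
      then show ?thesis using True by (auto simp: level_image[OF f])
    qed (simp add: level_image[OF f])
    fix s t assume "s \<in> ?S" "\<exists>u\<in>?S. s < u" "t \<in> imm_succ ?T s"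
    then obtain u v where u: "u \<in> short_words b k" "s = f u" and v: "v \<in> short_words b k" "f u < f v"
      by (elim imageE bexE) blast
    then have "u < v" using successor_map_less_iff[OF f] by simp
    then obtain i w where "v = u @ i # w" by (rule strict_prefixE') blast
    then have lu: "Suc (length u) < k" using v(1) by (simp add: short_words_def)
    have "g u @ [i] \<le> g (u @ [i])" "u @ [i] \<in> short_words b k"
      using \<open>v = u @ i # w\<close> v(1) g short_words_appendD[of "u @ [i]" w] by (auto simp: successor_map_def)
    then have gui: "g u @ [i] \<in> short_words b H" using g_in short_words_prefix by blast
    have "t \<in> (\<lambda>i. e (g u @ [i])) ` {..<b}"
      using \<open>t \<in> imm_succ ?T s\<close> imm_succ_image[OF e g_in[OF u(1)]] gui u(2)
      by (simp add: f_def short_words_def)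
    then obtain j where j: "j < b" "t = e (g u @ [j])" by auto
    have guj: "g u @ [j] \<in> short_words b H" using gui j(1) by (simp add: short_words_def)
    have ui': "u @ [i'] \<in> short_words b k" if "i' < b" for i'
      using u(1) lu that by (simp add: short_words_def)
    have key: "t \<le> f (u @ [i']) \<longleftrightarrow> i' = j" if "i' < b" for i'
    proof -
      have "t \<le> f (u @ [i']) \<longleftrightarrow> g u @ [j] \<le> g (u @ [i'])"
        unfolding j(2) f_def comp_apply using successor_map_le_iff[OF e guj g_in[OF ui'[OF that]]] .
      moreover have "g u @ [i'] \<le> g (u @ [i'])" using g ui'[OF that] by (simp add: successor_map_def)
      ultimately show ?thesis by (auto simp: less_eq_list_def prefix_def)
    qed
    show "\<exists>!s'. s' \<in> imm_succ ?S s \<and> t \<le> s'"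
      unfolding u(2) imm_succ_image[OF f u(1) lu] using key j(1) by (intro ex1I[of _ "f (u @ [j])"]) auto
  qed
qed


lemma tree_len_predecessor:
  fixes X :: "nat list set"
  assumes "t \<in> X" "tree_len X t = Suc n"
  shows "\<exists>s\<in>X. s < t \<and> tree_len X s = n"
proof -
  let ?P = "{s \<in> X. s < t}"
  have card: "card ?P = Suc n" using assms(2) by (simp add: tree_len_def)
  then have "finite ?P" by (intro card_ge_0_finite) simp
  moreover have "?P \<noteq> {}"
  proof
    assume "?P = {}"
    then have "card ?P = 0" by (simp only: card.empty)
    with card show False by simp
  qed
  ultimately have P: "finite ?P" "?P \<noteq> {}" "card ?P = Suc n" using card by blast+
  then obtain s where s: "s \<in> ?P" "\<And>u. u \<in> ?P \<Longrightarrow> \<not> s < u"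
    using finite_has_maximal[of ?P] by (metis (no_types, lifting) less_le)
  have "{u \<in> X. u < s} = ?P - {s}"
  proof (intro subset_antisym subsetI)
    fix u assume "u \<in> ?P - {s}"
    then have "u \<in> X" "u < t" "u \<noteq> s" by auto
    moreover have "u \<le> s \<or> s \<le> u"
      using \<open>u < t\<close> s(1) by (intro prefixes_comparable[of _ t]) auto
    ultimately show "u \<in> {u \<in> X. u < s}" using s(2)[of u] by auto
  qed (use s(1) in auto)
  then have "tree_len X s = n" using P s(1) by (simp add: tree_len_def)
  then show ?thesis using s(1) by auto
qed

lemma tree_len_less:
  fixes X :: "nat list set"
  assumes "s < t" "s \<in> X"
  shows "tree_len X s < tree_len X t"
proof -
  have "{u \<in> X. u < t} \<subseteq> set (prefixes t)"
    by (auto dest!: less_imp_le simp: less_eq_list_def)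
  then have "finite {u \<in> X. u < t}" using finite_subset by blast
  moreover have "{u \<in> X. u < s} \<subset> {u \<in> X. u < t}" using assms by auto
  ultimately show ?thesis unfolding tree_len_def by (rule psubset_card_mono)
qed

lemma imm_succ_full_tree:
  assumes "t \<in> full_tree b" "i < b"
  shows "t @ [i] \<in> imm_succ (full_tree b) t"
proof -
  have "tree_len (full_tree b) s = length s" if "s \<in> full_tree b" for s
    using that by (intro tree_len_prefix_closed) (auto simp: full_tree_def less_eq_list_def prefix_def)
  then show ?thesis using assms by (simp add: imm_succ_def full_tree_def less_eq_list_def)
qed

lemma level_nonempty_iff:
  fixes T :: "nat list set"
  assumes "tree_height T = enat H" "T \<noteq> {}"
  shows "level T n \<noteq> {} \<longleftrightarrow> n < H"
proof -
  have down: "level T m \<noteq> {}" if "level T (m + d) \<noteq> {}" for m d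
    using that
  proof (induction d)
    case (Suc d)
    then obtain t where "t \<in> T" "tree_len T t = Suc (m + d)" by (auto simp: level_def)
    then obtain s where "s \<in> T" "tree_len T s = m + d" using tree_len_predecessor by blast
    then have "level T (m + d) \<noteq> {}" by (auto simp: level_def)
    then show ?case by (rule Suc.IH)
  qed simp
  obtain n0 where n0: "level T n0 = {}" and H: "H = Max {n. level T n \<noteq> {}} + 1"
    using assms(1) by (auto simp: tree_height_def split: if_splits)
  have "{n. level T n \<noteq> {}} \<subseteq> {..<n0}"
  proof
    fix n assume "n \<in> {n. level T n \<noteq> {}}"
    then show "n \<in> {..<n0}" using n0 down[of n0 "n - n0"] by (cases "n < n0") auto
  qed
  then have fin: "finite {n. level T n \<noteq> {}}" using finite_subset by blast
  obtain t where "t \<in> T" using assms(2) by blast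
  then have ne: "{n. level T n \<noteq> {}} \<noteq> {}" by (auto simp: level_def)
  show ?thesis
  proof
    assume "level T n \<noteq> {}"
    then show "n < H" using Max_ge[OF fin, of n] H by simp
  next
    assume "n < H"
    then have "n + (H - 1 - n) = H - 1" by simp
    moreover have "level T (H - 1) \<noteq> {}" using Max_in[OF fin ne] H by simp
    ultimately have "level T (n + (H - 1 - n)) \<noteq> {}" by (simp only: simp_thms)
    then show "level T n \<noteq> {}" by (rule down)
  qed
qed

text \<open>
  \<open>e\<close> follows the letters of a word upwards from the root \<open>r\<close>, each time to the unique immediate
  successor in \<open>T\<close> that lies in the direction of the letter. This is possible at all nodes below the
  top level, since balancedness prevents a shorter maximal chain. Every node is reached, by induction
  on its length from its predecessor.
\<close>

lemma homogeneous_tree_parametrization: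
  assumes "homogeneous_tree b T"
  shows "\<exists>H e. tree_height T = enat H \<and> successor_map b H e \<and> T = e ` short_words b H"
proof -
  let ?F = "full_tree b"
  from assms have T: "T \<subseteq> ?F" "uniquely_rooted T" "balanced T"
    and succ: "\<And>s t. s \<in> T \<Longrightarrow> \<exists>u\<in>T. s < u \<Longrightarrow> t \<in> imm_succ ?F s \<Longrightarrow> \<exists>!s'. s' \<in> imm_succ T s \<and> t \<le> s'"
    unfolding homogeneous_tree_def strong_subtree_def by blast+
  from assms obtain H where H: "tree_height T = enat H" unfolding homogeneous_tree_def by auto
  obtain r where r: "level T 0 = {r}"
    using T(2) unfolding uniquely_rooted_def by (auto simp: card_1_singleton_iff)
  then have "T \<noteq> {}" by (auto simp: level_def)
  note lev = level_nonempty_iff[OF H this]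
  have fin: "finite {s \<in> T. s < t}" if "t \<in> T" for t
    using is_tree_lists[OF \<open>T \<noteq> {}\<close>] that unfolding is_tree_def by blast
  have "0 < H" using lev[of 0] r by simp
  then obtain top where top: "top \<in> T" "tree_len T top = H - 1"
    using lev[of "H - 1"] by (auto simp: level_def)
  have short: "tree_len T t < H" if "t \<in> T" for t
    using lev[of "tree_len T t"] that by (auto simp: level_def)
  have extendable: "\<exists>u\<in>T. t < u" if t: "t \<in> T" "Suc (tree_len T t) < H" for t
  proof (rule ccontr)
    assume "\<not> ?thesis"
    then have "pred_on.maxchain T (<) {s \<in> T. s \<le> t}"
      using t by (intro maxchain_below_maximal) auto
    moreover have "\<not> top < u" if "u \<in> T" for u
      using tree_len_less[of top u T] top short[OF that] by fastforce
    then have "pred_on.maxchain T (<) {s \<in> T. s \<le> top}"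
      using top by (intro maxchain_below_maximal) auto
    ultimately have "{s \<in> T. s \<le> t} \<approx> {s \<in> T. s \<le> top}"
      using T(3) unfolding balanced_def by blast
    then have "card {s \<in> T. s \<le> t} = card {s \<in> T. s \<le> top}"
      by (auto simp: eqpoll_def intro: bij_betw_same_card)
    then show False using t top \<open>0 < H\<close> by (simp add: card_below fin)
  qed
  define step where "step t i = (THE s. s \<in> imm_succ T t \<and> t @ [i] \<le> s)" for t i
  have step: "step t i \<in> imm_succ T t \<and> t @ [i] \<le> step t i"
    and step_unique: "\<And>s. s \<in> imm_succ T t \<Longrightarrow> t @ [i] \<le> s \<Longrightarrow> s = step t i"
    if "t \<in> T" "Suc (tree_len T t) < H" "i < b" for t i
  proof -
    have ex1: "\<exists>!s. s \<in> imm_succ T t \<and> t @ [i] \<le> s"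
      using that T(1) by (intro succ extendable imm_succ_full_tree) auto
    then show "step t i \<in> imm_succ T t \<and> t @ [i] \<le> step t i" unfolding step_def by (rule theI')
    with ex1 show "\<And>s. s \<in> imm_succ T t \<Longrightarrow> t @ [i] \<le> s \<Longrightarrow> s = step t i" by blast
  qed
  define e where "e = foldl step r"
  have e_Suc: "e (u @ [i]) = step (e u) i" for u i by (simp add: e_def)
  have e: "e u \<in> T \<and> tree_len T (e u) = length u" if "u \<in> short_words b H" for u
    using that
  proof (induction u rule: rev_induct)
    case Nil
    then show ?case using r by (auto simp: e_def level_def)
  next
    case (snoc i u)
    then have IH: "e u \<in> T" "tree_len T (e u) = length u" using short_words_appendD by blast+
    then have "step (e u) i \<in> imm_succ T (e u)"
      using step[of "e u" i] snoc.prems by (simp add: short_words_def)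
    then show ?case using IH by (simp add: e_Suc imm_succ_def)
  qed
  have "successor_map b H e"
    unfolding successor_map_def
  proof (intro allI impI)
    fix u i assume ui: "u @ [i] \<in> short_words b H"
    then have "e u \<in> T" "tree_len T (e u) = length u" using e short_words_appendD by blast+
    then show "e u @ [i] \<le> e (u @ [i])"
      using step[of "e u" i] ui by (simp add: e_Suc short_words_def)
  qed
  moreover have "t \<in> e ` short_words b H" if "t \<in> T" "tree_len T t = n" for t n
    using that
  proof (induction n arbitrary: t)
    case 0
    then have "t = e []" using r by (auto simp: level_def e_def)
    then show ?case using \<open>0 < H\<close> by (auto simp: short_words_def)
  next
    case (Suc n)
    then obtain s where s: "s \<in> T" "s < t" "tree_len T s = n" using tree_len_predecessor by blast
    then obtain u where u: "u \<in> short_words b H" "s = e u" using Suc.IH by blast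
    obtain i w where t: "t = s @ i # w" using s(2) by (rule strict_prefixE')
    then have "i < b" using Suc.prems T(1) by (auto simp: full_tree_def)
    have n: "Suc n < H" using short[OF Suc.prems(1)] Suc.prems(2) by simp
    have "t = step s i"
      using s Suc.prems \<open>i < b\<close> n by (intro step_unique) (auto simp: imm_succ_def t less_eq_list_def)
    then have "t = e (u @ [i])" by (simp add: e_Suc u(2))
    moreover have "u @ [i] \<in> short_words b H"
      using u e[OF u(1)] s(3) n \<open>i < b\<close> by (simp add: short_words_def)
    ultimately show ?case by blast
  qed
  ultimately show ?thesis using e H by blast
qed

lemma strong_copy_props:
  assumes "strong_copy b ns s g"
  shows "u \<in> short_words b (length ns) \<Longrightarrow> s \<le> g u \<and> g u \<in> words b (ns ! length u)"
    and "u @ [i] \<in> short_words b (length ns) \<Longrightarrow> g u @ [i] \<le> g (u @ [i])"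
proof -
  have "(u \<in> short_words b (length ns) \<longrightarrow> s \<le> g u \<and> g u \<in> words b (ns ! length u)) \<and>
    (u @ [i] \<in> short_words b (length ns) \<longrightarrow> g u @ [i] \<le> g (u @ [i]))" for u
    using assms
  proof (induction ns arbitrary: s g u)
    case Nil
    then show ?case by (simp add: short_words_def)
  next
    case (Cons n ns)
    show ?case
    proof (cases u)
      case Nil
      then show ?thesis using Cons.prems Cons.IH[of "g [] @ [i]" "\<lambda>v. g (i # v)" "[]"]
        by (auto simp: short_words_def)
    next
      case (Cons j v)
      show ?thesis
      proof (cases "j < b")
        case True
        then have "strong_copy b ns (g [] @ [j]) (\<lambda>v. g (j # v))" using Cons.prems by simp
        note IH = Cons.IH[OF this, of v]
        have "s \<le> g []" using Cons.prems by simp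
        moreover have "g [] \<le> g [] @ [j]" by (simp add: less_eq_list_def)
        ultimately have "s \<le> g u" if "g [] @ [j] \<le> g u" using that order_trans by blast
        then show ?thesis using IH True \<open>u = j # v\<close> by (auto simp: short_words_def)
      qed (use Cons in \<open>simp add: short_words_def\<close>)
    qed
  qed
  then show "u \<in> short_words b (length ns) \<Longrightarrow> s \<le> g u \<and> g u \<in> words b (ns ! length u)"
    and "u @ [i] \<in> short_words b (length ns) \<Longrightarrow> g u @ [i] \<le> g (u @ [i])" by blast+
qed

text \<open>
  All factors lie in \<open>[0,1]\<close>, and one of them vanishes as soon as \<open>P\<close> fails at a node.
\<close>

lemma node_prod_indicator:
  "node_prod b (\<lambda>t Z. of_bool (P t Z)) k g Z \<le> of_bool (\<forall>u\<in>short_words b k. P (g u) Z)"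
proof (induction k arbitrary: g)
  case 0
  then show ?case by (simp add: short_words_def)
next
  case (Suc k)
  let ?X = "\<lambda>t Z. of_bool (P t Z) :: real"
  have nonneg: "0 \<le> node_prod b ?X k g Z" for g by (rule node_prod_nonneg) simp
  show ?case
  proof (cases "\<forall>u\<in>short_words b (Suc k). P (g u) Z")
    case True
    have "node_prod b ?X k g Z \<le> 1" for g using Suc.IH[of g] by (auto intro: order_trans)
    then have "node_prod b ?X (Suc k) g Z \<le> 1"
      using nonneg by (auto intro!: mult_le_one prod_le_1 prod_nonneg)
    then show ?thesis using True by simp
  next
    case False
    then obtain u where u: "u \<in> short_words b (Suc k)" "\<not> P (g u) Z" by blast
    show ?thesis
    proof (cases u)
      case Nil
      then show ?thesis using u by simp
    next
      case (Cons i v)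
      then have i: "i < b" "v \<in> short_words b k" using u by (auto simp: short_words_def)
      then have "node_prod b ?X k (\<lambda>u. g (i # u)) Z \<le> 0"
        using Suc.IH[of "\<lambda>u. g (i # u)"] u Cons by (auto simp: of_bool_def split: if_splits)
      then have "node_prod b ?X k (\<lambda>u. g (i # u)) Z = 0" using nonneg antisym by blast
      then have "(\<Prod>i<b. node_prod b ?X k (\<lambda>u. g (i # u)) Z) = 0" using i(1) by (intro prod_zero) auto
      then have "node_prod b ?X (Suc k) g Z = 0" by (simp only: node_prod.simps mult_zero_right)
      with False show ?thesis by (simp only: simp_thms of_bool_eq order_refl)
    qed
  qed
qed

section \<open>Probability spaces and the theorem\<close>

text \<open>
  The atom of the algebra generated by the events to which \<open>\<omega>\<close> belongs, recorded as a subset of the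
  index set.
\<close>

definition events_at :: "'t set \<Rightarrow> ('t \<Rightarrow> 'w set) \<Rightarrow> 'w \<Rightarrow> 't set" where
  "events_at T A \<omega> = {t \<in> T. \<omega> \<in> A t}"

lemma measurable_events_at:
  assumes "finite T" "\<forall>t\<in>T. A t \<in> sets M"
  shows "events_at T A \<in> M \<rightarrow>\<^sub>M count_space (Pow T)"
proof -
  have "events_at T A -` {Z} \<inter> space M \<in> sets M" if "Z \<subseteq> T" for Z
  proof -
    have "events_at T A -` {Z} \<inter> space M = {\<omega> \<in> space M. \<forall>t\<in>T. (\<omega> \<in> A t) = (t \<in> Z)}"
    proof -
      have "events_at T A \<omega> = Z \<longleftrightarrow> (\<forall>t\<in>T. (\<omega> \<in> A t) = (t \<in> Z))" for \<omega>
        using that unfolding events_at_def by blast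
      then show ?thesis by auto
    qed
    also have "\<dots> \<in> sets M"
    proof (rule sets.sets_Collect_finite_All[where P = "\<lambda>t \<omega>. (\<omega> \<in> A t) = (t \<in> Z)", OF _ assms(1)])
      fix t assume "t \<in> T"
      then have "A t \<in> sets M" using assms(2) by blast
      moreover have "{\<omega> \<in> space M. (\<omega> \<in> A t) = (t \<in> Z)} = (if t \<in> Z then A t \<inter> space M else space M - A t)"
        by (cases "t \<in> Z") auto
      ultimately show "{\<omega> \<in> space M. (\<omega> \<in> A t) = (t \<in> Z)} \<in> sets M" by simp
    qed
    finally show ?thesis .
  qed
  then show ?thesis
    using assms(1) by (subst measurable_count_space_eq_countable) (auto simp: events_at_def countable_finite)
qed

text \<open>
  Every \<open>f\<close> is allowed here: its composition with \<open>events_at T A\<close> takes finitely many values.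
\<close>

lemma averaging_events_at:
  assumes "prob_space M" "finite T" "\<forall>t\<in>T. A t \<in> sets M"
  shows "averaging (\<lambda>f. \<integral>\<omega>. f (events_at T A \<omega>) \<partial>M)"
proof -
  interpret prob_space M by fact
  have int: "integrable M (\<lambda>\<omega>. f (events_at T A \<omega>))" for f :: "_ \<Rightarrow> real"
  proof (rule integrable_const_bound)
    show "AE \<omega> in M. norm (f (events_at T A \<omega>)) \<le> (\<Sum>Z\<in>Pow T. norm (f Z))"
      using assms(2) by (intro AE_I2 member_le_sum) (auto simp: events_at_def)
    show "(\<lambda>\<omega>. f (events_at T A \<omega>)) \<in> borel_measurable M"
      using measurable_events_at[OF assms(2,3)] by (rule measurable_compose) simp
  qed
  show ?thesis
    unfolding averaging_def using int by (auto simp: prob_space intro: Bochner_Integration.integral_nonneg)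
qed

lemma integral_events_at_subset:
  assumes "prob_space M" "finite T" "\<forall>t\<in>T. A t \<in> sets M" "S \<subseteq> T" "S \<noteq> {}"
  shows "(\<integral>\<omega>. of_bool (S \<subseteq> events_at T A \<omega>) \<partial>M) = measure M (\<Inter>t\<in>S. A t)"
proof -
  have "(\<integral>\<omega>. of_bool (S \<subseteq> events_at T A \<omega>) \<partial>M) = (\<integral>\<omega>. indicator (\<Inter>t\<in>S. A t) \<omega> \<partial>M)"
    using assms(4) by (intro Bochner_Integration.integral_cong) (auto simp: events_at_def indicator_def)
  also have "(\<Inter>t\<in>S. A t) \<in> sets M"
    using assms by (intro sets.finite_INT) (auto intro: finite_subset)
  then have "(\<integral>\<omega>. indicator (\<Inter>t\<in>S. A t) \<omega> \<partial>M) = measure M (\<Inter>t\<in>S. A t)"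
    by (simp only: Bochner_Integration.integral_indicator sets.Int_space_eq2)
  finally show ?thesis .
qed

text \<open>
  The exponent in the theorem is the geometric sum with ratio \<open>2 ^ b - 1 \<ge> b\<close>.
\<close>

lemma exponent_ge:
  assumes "2 \<le> b"
  shows "real (\<Sum>i<k. b ^ i) \<le> exponent b k"
proof -
  have "Suc b \<le> 2 ^ b" by (rule Suc_leI) (rule less_exp)
  then have "real (Suc b) \<le> real (2 ^ b)" by (rule of_nat_mono)
  then have b: "real b \<le> 2 ^ b - 1" by simp
  define q :: real where "q = 2 ^ b - 1"
  have "q \<noteq> 1" using b assms by (simp add: q_def)
  have "real (\<Sum>i<k. b ^ i) = (\<Sum>i<k. real b ^ i)" by simp
  also have "\<dots> \<le> (\<Sum>i<k. q ^ i)" using b by (intro sum_mono power_mono) (auto simp: q_def)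
  also have "\<dots> = (q ^ k - 1) / (q - 1)" using \<open>q \<noteq> 1\<close> by (rule geometric_sum)
  finally show ?thesis by (simp add: exponent_def q_def)
qed

text \<open>
  The strict inequality \<open>\<theta> < \<epsilon>\<close> leaves the room \<open>\<delta> = \<epsilon> ^ p - \<theta> ^ p\<close> for the approximation
  errors. Only the first \<open>N\<close> levels of the tree are used.
\<close>

lemma exists_sufficient_height:
  fixes \<theta> \<epsilon> :: real
  assumes "2 \<le> b" "1 \<le> k" "0 < \<theta>" "\<theta> < \<epsilon>" "\<epsilon> \<le> 1"
  shows "\<exists>N. sufficient_height TYPE('w) b k \<theta> \<epsilon> N"
proof -
  define p where "p = (\<Sum>i<k. b ^ i)"
  have "0 < p" using assms by (cases k) (simp_all add: p_def sum.lessThan_Suc_shift del: sum.lessThan_Suc)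
  then have gap: "0 < \<epsilon> ^ p - \<theta> ^ p" using assms by (simp add: power_strict_mono)
  have b: "0 < b" and k: "0 < k" and \<epsilon>0: "0 \<le> \<epsilon>" using assms by auto
  have "\<theta> powr exponent b k \<le> \<theta> powr real p"
    using assms exponent_ge[of b k] by (intro powr_mono') (auto simp: p_def)
  then have \<theta>: "\<theta> powr exponent b k \<le> \<theta> ^ p" using assms(3) by (simp add: powr_realpow)
  obtain N where N: "\<forall>(E :: (nat list set \<Rightarrow> real) \<Rightarrow> real) X. averaging E \<longrightarrow>
      (\<forall>t x. 0 \<le> X t x \<and> X t x \<le> 1) \<longrightarrow> (\<forall>n<N. \<forall>t\<in>words b n. \<epsilon> \<le> E (X t)) \<longrightarrow>
      (\<exists>ns. length ns = k \<and> sorted_wrt (<) ns \<and> set ns \<subseteq> {..<N} \<and>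
         \<epsilon> ^ p - (\<epsilon> ^ p - \<theta> ^ p) \<le> E (tree_avg b X ns []))"
    using levels_with_large_average[OF b k gap \<epsilon>0, folded p_def] by (rule exE) (rule that)
  have "sufficient_height TYPE('w) b k \<theta> \<epsilon> N"
    unfolding sufficient_height_def
  proof (intro allI impI)
    fix T and M :: "'w measure" and A
    assume T: "homogeneous_tree b T" "enat N \<le> tree_height T" and M: "prob_space M"
      and A: "\<forall>t\<in>T. A t \<in> sets M" "\<forall>t\<in>T. \<epsilon> \<le> measure M (A t)"
    obtain H e where e: "tree_height T = enat H" "successor_map b H e" "T = e ` short_words b H"
      using homogeneous_tree_parametrization[OF T(1)] by (elim exE conjE) (rule that)
    have fin: "finite T" using e(3) finite_short_words by simp
    have "N \<le> H" using T(2) e(1) by simp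
    define E where "E f = (\<integral>\<omega>. f (events_at T A \<omega>) \<partial>M)" for f :: "nat list set \<Rightarrow> real"
    have E: "averaging E" unfolding E_def[abs_def] by (rule averaging_events_at[OF M fin A(1)])
    have E_subset: "E (\<lambda>Z. of_bool (S \<subseteq> Z)) = measure M (\<Inter>t\<in>S. A t)" if "S \<subseteq> T" "S \<noteq> {}" for S
      unfolding E_def using integral_events_at_subset[OF M fin A(1) that] .
    define X :: "nat list \<Rightarrow> nat list set \<Rightarrow> real" where "X = (\<lambda>u Z. of_bool (e u \<in> Z))"
    have X: "0 \<le> X t x" "X t x \<le> 1" for t x by (simp_all add: X_def)
    have "\<epsilon> \<le> E (X u)" if "n < N" "u \<in> words b n" for n u
    proof -
      have "e u \<in> T" using that \<open>N \<le> H\<close> e(3) by (auto simp: words_def short_words_def)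
      then have "E (X u) = measure M (A (e u))" using E_subset[of "{e u}"] by (simp add: X_def)
      then show ?thesis using A(2) \<open>e u \<in> T\<close> by simp
    qed
    then obtain ns where ns: "length ns = k" "sorted_wrt (<) ns" "set ns \<subseteq> {..<N}"
      "\<theta> ^ p \<le> E (tree_avg b X ns [])"
      using N[rule_format, of E X] E X by auto
    obtain g where g: "strong_copy b ns [] g"
      "E (\<lambda>x. 1 * tree_avg b X ns [] x) \<le> E (\<lambda>x. 1 * node_prod b X (length ns) g x)"
      using exists_strong_copy[where X = X, OF E b X, of "\<lambda>_. 1" ns "[]"] ns(2) by auto
    have g_words: "g u \<in> words b (ns ! length u)" if "u \<in> short_words b k" for u
      using strong_copy_props(1)[OF g(1)] that ns(1) by simp
    have g_in: "g u \<in> short_words b H" if "u \<in> short_words b k" for u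
    proof -
      have "ns ! length u \<in> set ns" using that ns(1) by (simp add: short_words_def)
      then have "ns ! length u < H" using ns(3) \<open>N \<le> H\<close> by auto
      then show ?thesis using g_words[OF that] by (simp add: words_def short_words_def)
    qed
    have "successor_map b k g"
      using strong_copy_props(2)[OF g(1)] ns(1) by (simp add: successor_map_def)
    note S = strong_subtree_image[OF b k e(2) this g_in, of "\<lambda>n. ns ! n"]
    let ?S = "e ` g ` short_words b k"
    have "strong_subtree T ?S" "tree_height ?S = enat k"
      using S g_words unfolding e(3) by (auto simp: words_def)
    moreover have "\<theta> powr exponent b k \<le> measure M (\<Inter>t\<in>?S. A t)"
    proof -
      have "[] \<in> short_words b k" using k by (simp add: short_words_def)
      then have "?S \<noteq> {}" by blast
      moreover have "?S \<subseteq> T" using g_in e(3) by auto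
      moreover have "E (node_prod b X k g) \<le> E (\<lambda>Z. of_bool (?S \<subseteq> Z))"
      proof (rule averaging_mono[OF E])
        fix Z
        show "node_prod b X k g Z \<le> of_bool (?S \<subseteq> Z)"
          using node_prod_indicator[of b "\<lambda>u Z. e u \<in> Z" k g Z] by (simp add: X_def image_subset_iff)
      qed
      ultimately show ?thesis using \<theta> ns(1,4) g(2) E_subset by simp
    qed
    ultimately show "\<exists>S. strong_subtree T S \<and> tree_height S = enat k \<and>
        \<theta> powr exponent b k \<le> measure M (\<Inter>t\<in>S. A t)" by blast
  qed
  then show ?thesis by blast
qed

text \<open>
  The push-forward of \<open>M\<close> under a numbering of the atoms is a probability space on \<open>nat\<close>, and the
  corresponding events \<open>A'\<close> have intersections of the same measure as those of \<open>A\<close>. Non-emptiness of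
  \<open>S\<close> matters, since an empty intersection is the whole type.
\<close>

lemma sufficient_height_transfer:
  assumes N: "sufficient_height TYPE(nat) b k \<theta> \<epsilon> N"
  shows "sufficient_height TYPE('w) b k \<theta> \<epsilon> N"
  unfolding sufficient_height_def
proof (intro allI impI)
  fix T and M :: "'w measure" and A
  assume T: "homogeneous_tree b T" "enat N \<le> tree_height T" and M: "prob_space M"
    and A: "\<forall>t\<in>T. A t \<in> sets M" "\<forall>t\<in>T. \<epsilon> \<le> measure M (A t)"
  have fin: "finite T" using homogeneous_tree_parametrization[OF T(1)] finite_short_words by (metis finite_imageI)
  obtain code :: "nat list set \<Rightarrow> nat" where code: "inj_on code (Pow T)"
    using finite_imp_inj_to_nat_seg[of "Pow T"] fin by auto
  define M' where "M' = distr M (count_space UNIV) (code \<circ> events_at T A)"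
  define A' where "A' t = code ` {Z \<in> Pow T. t \<in> Z}" for t
  have meas: "code \<circ> events_at T A \<in> M \<rightarrow>\<^sub>M count_space UNIV"
    using measurable_events_at[OF fin A(1)] by (rule measurable_comp) simp
  have M': "prob_space M'" unfolding M'_def by (rule prob_space.prob_space_distr[OF M meas])
  have eq: "measure M' (\<Inter>t\<in>S. A' t) = measure M (\<Inter>t\<in>S. A t)" if "S \<subseteq> T" "S \<noteq> {}" for S
  proof -
    have into: "(\<Inter>t\<in>S. A t) \<subseteq> space M" using that A(1) sets.sets_into_space by blast
    have mem: "code (events_at T A \<omega>) \<in> A' t \<longleftrightarrow> \<omega> \<in> A t" if "t \<in> T" for \<omega> t
    proof -
      have "events_at T A \<omega> \<in> Pow T" by (auto simp: events_at_def)
      then have "code (events_at T A \<omega>) \<in> A' t \<longleftrightarrow> t \<in> events_at T A \<omega>"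
        unfolding A'_def using inj_on_image_mem_iff[OF code, of "events_at T A \<omega>" "{Z \<in> Pow T. t \<in> Z}"] by blast
      then show ?thesis using that by (simp add: events_at_def)
    qed
    have "(code \<circ> events_at T A) -` (\<Inter>t\<in>S. A' t) = (\<Inter>t\<in>S. A t)"
    proof (intro set_eqI)
      fix \<omega>
      have "\<omega> \<in> (code \<circ> events_at T A) -` (\<Inter>t\<in>S. A' t) \<longleftrightarrow> (\<forall>t\<in>S. code (events_at T A \<omega>) \<in> A' t)"
        by simp
      also have "\<dots> \<longleftrightarrow> (\<forall>t\<in>S. \<omega> \<in> A t)" using mem \<open>S \<subseteq> T\<close> by (intro ball_cong) auto
      finally show "\<omega> \<in> (code \<circ> events_at T A) -` (\<Inter>t\<in>S. A' t) \<longleftrightarrow> \<omega> \<in> (\<Inter>t\<in>S. A t)" by simp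
    qed
    then have "(code \<circ> events_at T A) -` (\<Inter>t\<in>S. A' t) \<inter> space M = (\<Inter>t\<in>S. A t)"
      using into by blast
    then show ?thesis unfolding M'_def by (subst measure_distr[OF meas]) simp_all
  qed
  have "\<forall>t\<in>T. A' t \<in> sets M'" by (simp add: M'_def)
  moreover have "\<forall>t\<in>T. \<epsilon> \<le> measure M' (A' t)" using eq[of "{_}"] A(2) by simp
  ultimately obtain S where S: "strong_subtree T S" "tree_height S = enat k"
    "\<theta> powr exponent b k \<le> measure M' (\<Inter>t\<in>S. A' t)"
    using N T M' unfolding sufficient_height_def by blast
  have "S \<subseteq> T" "S \<noteq> {}"
    using S(1) by (auto simp: strong_subtree_def uniquely_rooted_def level_def)
  then show "\<exists>S. strong_subtree T S \<and> tree_height S = enat k \<and>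
      \<theta> powr exponent b k \<le> measure M (\<Inter>t\<in>S. A t)"
    using S eq by auto
qed

theorem theorem4:
  fixes b k :: nat and \<theta> \<epsilon> :: real
  assumes "b \<ge> 2" and "k \<ge> 1" and "0 < \<theta>" and "\<theta> < \<epsilon>" and "\<epsilon> \<le> 1"
  shows "(\<exists>N. sufficient_height TYPE('w) b k \<theta> \<epsilon> N) \<and>
         (\<forall>N. sufficient_height TYPE(nat) b k \<theta> \<epsilon> N \<longrightarrow>
              sufficient_height TYPE('w) b k \<theta> \<epsilon> N)"
  using exists_sufficient_height[OF assms] sufficient_height_transfer by blast

end
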